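(* Let $0<t<1$, let $a,b\in\mathbb C$, and let $K_n$ be the normalized reproducing kernel for the potential $V(z)=|z|^2-\mathrm{Re}(tz^2)$. If $z_0$ lies inside of the ellipse $\partial E_t$, then $$\lim_{n\to\infty}\left|\frac1nK_n\left(z_0+\frac a{\sqrt n},z_0+\frac b{\sqrt n}\right)\right|=\frac1\pi e^{-\frac{|a-b|^2}2}.$$ If $z_0=a_t\cos\phi+i\,b_t\sin\phi\in\partial E_t$ with $\phi\in(-\pi,\pi]$, then $$\lim_{n\to\infty}\left|\frac1nK_n\left(z_0+\frac{ae^{i\psi}}{\sqrt n},z_0+\frac{be^{i\psi}}{\sqrt n}\right)\right|=\frac1{2\pi}e^{-\frac{|a-b|^2}2}\left|\mathrm{erfc}\left(\frac{\overline a+b}{\sqrt2}\right)\right|,$$ where $$\psi=\begin{cases}\arctan\left(\frac{1+t}{1-t}\tan\phi\right)&\text{if }\phi\in(-\frac\pi2,\frac\pi2),\\ \arctan\left(\frac{1+t}{1-t}\tan\phi\right)+\mathrm{sign}(\phi)\pi&\text{if }\phi\notin[-\frac\pi2,\frac\pi2],\\ \phi&\text{if }\phi=\pm\frac\pi2.\end{cases}$$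
   Context: For $n\in\mathbb N$, let $(p_{k,n})_{k\ge0}$ be the polynomials with $\deg p_{k,n}=k$ and positive leading coefficient satisfying $\int_{\mathbb C}\overline{p_{k,n}(z)}p_{l,n}(z)e^{-nV(z)}\,d^2z=\delta_{kl}$ ($d^2z$ is Lebesgue measure). The normalized reproducing kernel is $K_n(w,z)=e^{-\frac n2(V(w)+V(z))}\sum_{k=0}^{n-1}\overline{p_{k,n}(w)}\,p_{k,n}(z)$. Let $a_t=\sqrt{\frac{1+t}{1-t}}$, $b_t=\sqrt{\frac{1-t}{1+t}}$ and $\partial E_t=\{z\in\mathbb C:\frac{(\mathrm{Re}\,z)^2}{a_t^2}+\frac{(\mathrm{Im}\,z)^2}{b_t^2}=1\}$; "inside" means the left-hand side is $<1$. $\mathrm{erfc}(z)=\frac{2}{\sqrt\pi}\int_z^\infty e^{-w^2}dw$ (entire function). *)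

theory Defs
  imports "HOL-Analysis.Analysis" "HOL-Computational_Algebra.Polynomial"
begin

text \<open>The index \<open>n\<close> of the weight is fixed, so \<open>p k\<close> is the polynomial $p_{k,n}$. The measure
  \<open>lborel\<close> at type \<open>complex\<close> is planar Lebesgue measure $d^2z$; \<open>has_bochner_integral\<close> asserts
  integrability as well as the value of the integral.\<close>

definition orthonormal_polys :: "(complex \<Rightarrow> real) \<Rightarrow> nat \<Rightarrow> (nat \<Rightarrow> complex poly) \<Rightarrow> bool" where
  "orthonormal_polys V n p \<longleftrightarrow>
     (\<forall>k. degree (p k) = k) \<and>
     (\<forall>k. \<exists>c::real. c > 0 \<and> lead_coeff (p k) = of_real c) \<and>
     (\<forall>k l. has_bochner_integral lborel
        (\<lambda>z. cnj (poly (p k) z) * poly (p l) z * of_real (exp (- real n * V z)))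
        (if k = l then 1 else 0))"

definition reproducing_kernel ::
    "(complex \<Rightarrow> real) \<Rightarrow> nat \<Rightarrow> (nat \<Rightarrow> complex poly) \<Rightarrow> complex \<Rightarrow> complex \<Rightarrow> complex" where
  "reproducing_kernel V n p w z =
     of_real (exp (- (real n / 2) * (V w + V z))) *
     (\<Sum>k<n. cnj (poly (p k) w) * poly (p k) z)"

definition elliptic_potential :: "real \<Rightarrow> complex \<Rightarrow> real" where
  "elliptic_potential t z = (cmod z)\<^sup>2 - Re (of_real t * z\<^sup>2)"

definition semiaxis_a :: "real \<Rightarrow> real" where
  "semiaxis_a t = sqrt ((1 + t) / (1 - t))"

definition semiaxis_b :: "real \<Rightarrow> real" where
  "semiaxis_b t = sqrt ((1 - t) / (1 + t))"

definition ellipse :: "real \<Rightarrow> complex set" where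
  "ellipse t = {z. (Re z)\<^sup>2 / (semiaxis_a t)\<^sup>2 + (Im z)\<^sup>2 / (semiaxis_b t)\<^sup>2 = 1}"

definition ellipse_inside :: "real \<Rightarrow> complex set" where
  "ellipse_inside t = {z. (Re z)\<^sup>2 / (semiaxis_a t)\<^sup>2 + (Im z)\<^sup>2 / (semiaxis_b t)\<^sup>2 < 1}"

text \<open>The integral from \<open>z\<close> to $\infty$ is taken along the horizontal ray $w = z + s$, $s \ge 0$.\<close>

definition erfc :: "complex \<Rightarrow> complex" where
  "erfc z = of_real (2 / sqrt pi) * (LINT s:{0..}|lborel. exp (- (z + of_real s)\<^sup>2))"

definition normal_angle :: "real \<Rightarrow> real \<Rightarrow> real" where
  "normal_angle t \<phi> =
     (if \<phi> \<in> {- (pi / 2)<..<pi / 2} then arctan ((1 + t) / (1 - t) * tan \<phi>)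
      else if \<phi> \<notin> {- (pi / 2)..pi / 2} then arctan ((1 + t) / (1 - t) * tan \<phi>) + sgn \<phi> * pi
      else \<phi>)"

end

theory Submission
  imports Defs "HOL-Probability.Probability" "HOL-Complex_Analysis.Complex_Analysis"
    "HOL-Real_Asymp.Real_Asymp"
begin

text \<open>Integration by parts against the weight shows that differentiation and its adjoint act on the
  orthonormal polynomials as lowering and raising operators. This yields Mehler's formula: a closed
  form of \<open>\<Sum>k. s ^ k * p\<^sub>k(u) * p\<^sub>k(v)\<close>. On the diagonal it says that
  \<open>(\<pi> / n) * \<bar>p\<^sub>k(w)\<bar>\<^sup>2 * exp (- n V(w))\<close> is a probability distribution in the index
  \<open>k\<close> with an explicit generating function, and the kernel at \<open>(w, w)\<close> is \<open>n / \<pi>\<close> times the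
  probability of \<open>k < n\<close>. The mean index is asymptotically \<open>n\<close> times the quadratic form defining
  the ellipse. Inside the ellipse a Chernoff bound makes that probability tend to \<open>1\<close>; on the
  ellipse the central limit theorem makes it tend to a value of the Gaussian distribution function.
  After a change of gauge the rescaled kernel is holomorphic in \<open>b\<close>, antiholomorphic in \<open>a\<close> and
  locally bounded, so Vitali's theorem carries the limit from the diagonal \<open>a = b\<close> to all pairs.\<close>

section \<open>Integration by parts and Gaussian integrals\<close>

text \<open>Mehler's formula sums over all indices, whereas the kernel stops at
  \<open>k < n\<close>, and off the diagonal its terms are complex and may cancel. On the diagonal
  they are nonnegative, so truncation becomes an event that the generating function controls. The
  series converges for \<open>cmod s * t < 1\<close>. Since t < 1, this region contains the unit
  circle, which carries the characteristic function, and real radii slightly above 1, which the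
  Chernoff bound uses. Only the modulus of the kernel is at stake, so unimodular factors may be
  changed; this permits an entire substitute for the weight. On the ellipse, moving z0 by
  \<open>a / sqrt n\<close> in the normal direction shifts the mean index by about
  \<open>2 * L * Re a * sqrt n\<close>, while its standard deviation is about
  \<open>L * sqrt n\<close>, where L is half the length of the gradient of the quadratic form. The
  factor L cancels, so the limit depends neither on t nor on the boundary point.\<close>

lemma integrable_lborel_translate:
  fixes f :: "'a::euclidean_space \<Rightarrow> 'b::{banach,second_countable_topology}"
  assumes "integrable lborel f"
  shows "integrable lborel (\<lambda>z. f (z + c))" "(LINT z|lborel. f (z + c)) = (LINT z|lborel. f z)"
proof -
  have eq: "lborel = distr lborel borel (\<lambda>z::'a. z + c)"
    by (subst lborel_distr_plus[symmetric, of c]) (simp add: add.commute fun_eq_iff cong: distr_cong)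
  have [measurable]: "f \<in> borel_measurable borel"
    using borel_measurable_integrable[OF assms] by simp
  show "integrable lborel (\<lambda>z. f (z + c))"
    using assms by (subst (asm) eq, subst (asm) integrable_distr_eq) auto
  show "(LINT z|lborel. f (z + c)) = (LINT z|lborel. f z)"
    by (subst (2) eq, subst integral_distr) auto
qed

text \<open>Integrate \<open>h' (z + s *\<^sub>R e)\<close> over s in [0, 1] and over all z. Taking
  z first gives the integral of \<open>h'\<close> by translation invariance; taking s first gives
  \<open>h (z + e) - h z\<close>, whose integral is 0. Comparing translates instead of exhausting by
  boxes keeps boundary terms out.\<close>

lemma integral_directional_derivative_eq_0:
  fixes h h' :: "'a::euclidean_space \<Rightarrow> 'b::euclidean_space"
  assumes der: "\<And>z s. ((\<lambda>s. h (z + s *\<^sub>R e)) has_vector_derivative h' (z + s *\<^sub>R e)) (at s)"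
    and h: "integrable lborel h" and h': "integrable lborel h'" and cont: "continuous_on UNIV h'"
  shows "(LINT z|lborel. h' z) = 0"
proof -
  define f where "f = (\<lambda>(s::real, z). indicator {0..1} s *\<^sub>R h' (z + s *\<^sub>R e))"
  have [measurable]: "h' \<in> borel_measurable borel"
    using h' by simp
  have f_meas [measurable]: "f \<in> borel_measurable (lborel \<Otimes>\<^sub>M lborel)"
    unfolding f_def by measurable
  have tr: "integrable lborel (\<lambda>z. h' (z + c))" "(LINT z|lborel. h' (z + c)) = (LINT z|lborel. h' z)"
     "(LINT z|lborel. norm (h' (z + c))) = (LINT z|lborel. norm (h' z))" for c
    using integrable_lborel_translate[OF h'] integrable_lborel_translate[OF integrable_norm[OF h']] by auto
  have int: "integrable (lborel \<Otimes>\<^sub>M lborel) f"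
  proof (rule lborel_pair.Fubini_integrable[OF f_meas])
    have "integrable lborel (\<lambda>x. indicator {0..1::real} x *\<^sub>R (LINT z|lborel. norm (h' z)))"
      by simp
    then show "integrable lborel (\<lambda>x. LINT y|lborel. norm (f (x, y)))"
      by (simp add: f_def tr)
  qed (auto simp: f_def tr)
  have "(LINT z|lborel. (LINT s|lborel. f (s, z))) = (LINT s|lborel. (LINT z|lborel. f (s, z)))"
    using lborel_pair.integral_snd[of "\<lambda>s z. f (s, z)"] lborel_pair.integral_fst[of "\<lambda>s z. f (s, z)"] int by (simp add: case_prod_beta')
  also have "\<dots> = (LINT z|lborel. h' z)"
    by (simp add: f_def tr)
  also have "(\<lambda>z. LINT s|lborel. f (s, z)) = (\<lambda>z. h (z + e) - h z)"
  proof
    fix z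
    have "(LINT s|lborel. f (s, z)) = h (z + 1 *\<^sub>R e) - h (z + 0 *\<^sub>R e)"
      unfolding f_def prod.case
    proof (rule integral_FTC_atLeastAtMost)
      show "continuous_on {0..1} (\<lambda>x. h' (z + x *\<^sub>R e))"
        by (intro continuous_on_compose2[OF cont]) (auto intro!: continuous_intros)
    qed (auto intro: has_vector_derivative_at_within der)
    then show "(LINT s|lborel. f (s, z)) = h (z + e) - h z" by simp
  qed
  also have "(LINT z|lborel. h (z + e) - h z) = 0"
    using integrable_lborel_translate[OF h, of e] h by simp
  finally show ?thesis by simp
qed

lemma lborel_gaussian_real:
  assumes "\<alpha> > 0"
  shows "(\<integral>\<^sup>+x. ennreal (exp (- \<alpha> * x\<^sup>2)) \<partial>lborel) = ennreal (sqrt (pi / \<alpha>))"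
proof -
  define \<sigma> where "\<sigma> = sqrt (1 / (2 * \<alpha>))"
  have \<sigma>: "\<sigma> > 0" "\<sigma>\<^sup>2 = 1 / (2 * \<alpha>)"
    using assms by (auto simp: \<sigma>_def)
  have eq: "exp (- \<alpha> * x\<^sup>2) = sqrt (pi / \<alpha>) * normal_density 0 \<sigma> x" for x
    using assms \<sigma> by (simp add: normal_density_def \<sigma> field_simps)
  interpret prob_space "density lborel (normal_density 0 \<sigma>)"
    using \<sigma> by (intro prob_space_normal_density)
  have "(\<integral>\<^sup>+x. ennreal (normal_density 0 \<sigma> x) \<partial>lborel) = 1"
    using emeasure_space_1 by (simp add: emeasure_density)
  then show ?thesis
    unfolding eq using assms by (simp add: ennreal_mult' nn_integral_cmult)
qed

lemma lborel_gaussian_complex: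
  assumes "\<alpha> > 0" "\<beta> > 0"
  shows "(LINT z|lborel. exp (- (\<alpha> * (Re z)\<^sup>2 + \<beta> * (Im z)\<^sup>2))) = pi / sqrt (\<alpha> * \<beta>)"
proof -
  define f where "f = (\<lambda>b::complex. \<lambda>x::real. exp (- (if b = 1 then \<alpha> else \<beta>) * x\<^sup>2))"
  have "(\<integral>\<^sup>+z. ennreal (exp (- (\<alpha> * (Re z)\<^sup>2 + \<beta> * (Im z)\<^sup>2))) \<partial>lborel)
     = (\<integral>\<^sup>+z. (\<Prod>b\<in>Basis. ennreal (f b (z \<bullet> b))) \<partial>(lborel :: complex measure))"
    by (intro nn_integral_cong) (simp add: Basis_complex_def f_def exp_add[symmetric] prod_ennreal ennreal_mult'[symmetric] algebra_simps)
  also have "\<dots> = (\<Prod>b\<in>(Basis :: complex set). (\<integral>\<^sup>+x. ennreal (f b x) \<partial>lborel))"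
    by (rule nn_integral_lborel_prod) (auto simp: f_def)
  also have "\<dots> = ennreal (sqrt (pi / \<alpha>)) * ennreal (sqrt (pi / \<beta>))"
    using lborel_gaussian_real[OF assms(1)] lborel_gaussian_real[OF assms(2)]
    by (simp add: Basis_complex_def f_def)
  also have "\<dots> = ennreal (pi / sqrt (\<alpha> * \<beta>))"
    using assms by (simp add: ennreal_mult'[symmetric] real_sqrt_divide real_sqrt_mult field_simps)
  finally show ?thesis
    using assms by (intro integral_eq_nn_integral[THEN trans]) auto
qed

section \<open>Convergence from the diagonal\<close>

text \<open>If convergence failed at z, a subsequence would stay away from \<open>h z\<close>.
  Montel extracts from it a convergent one with entire limit; that limit agrees with h on the real
  line, hence everywhere by the identity theorem.\<close>

lemma Vitali_entire:
  fixes f :: "nat \<Rightarrow> complex \<Rightarrow> complex"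
  assumes f: "\<And>n. f n holomorphic_on UNIV" and h: "h holomorphic_on UNIV"
    and bound: "\<And>R. \<exists>B. \<forall>n z. cmod z \<le> R \<longrightarrow> cmod (f n z) \<le> B"
    and conv: "\<And>x. (\<lambda>n. f n (of_real x)) \<longlonglongrightarrow> h (of_real x)"
  shows "(\<lambda>n. f n z) \<longlonglongrightarrow> h z"
proof (rule ccontr)
  assume "\<not> (\<lambda>n. f n z) \<longlonglongrightarrow> h z"
  then obtain e where e: "e > 0" "\<not> (\<forall>\<^sub>F n in sequentially. dist (f n z) (h z) < e)"
    by (auto simp: tendsto_iff)
  define S where "S = {n. \<not> dist (f n z) (h z) < e}"
  have inf: "infinite S"
    using e(2) unfolding S_def eventually_cofinite[symmetric] cofinite_eq_sequentially by simp
  define q where "q = enumerate S"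
  have q: "strict_mono q" "\<And>n. \<not> dist (f (q n) z) (h z) < e"
    using strict_mono_enumerate[OF inf] enumerate_in_set[OF inf] by (auto simp: q_def S_def)
  have bdd: "\<exists>B. \<forall>k\<in>range (f \<circ> q). \<forall>z\<in>K. norm (k z) \<le> B" if K: "compact K" for K
  proof -
    obtain R where R: "\<forall>z\<in>K. cmod z \<le> R"
      using compact_imp_bounded[OF K] unfolding bounded_iff by (elim exE)
    obtain B where "\<forall>n z. cmod z \<le> R \<longrightarrow> cmod (f n z) \<le> B"
      using bound[of R] by (elim exE)
    with R show ?thesis by (intro exI[of _ B]) auto
  qed
  have "\<exists>g r. g holomorphic_on UNIV \<and> strict_mono (r :: nat \<Rightarrow> nat) \<and>
      (\<forall>x. (\<lambda>n. (f \<circ> q) (r n) x) \<longlonglongrightarrow> g x)"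
  proof (rule Montel[of UNIV "range (f \<circ> q)" "f \<circ> q"])
    show "\<exists>B. \<forall>h\<in>range (f \<circ> q). \<forall>z\<in>K. norm (h z) \<le> B" if "compact K" for K
      using that by (rule bdd)
    fix g and r :: "nat \<Rightarrow> nat"
    assume "g holomorphic_on UNIV" "strict_mono r"
      "\<And>x. x \<in> UNIV \<Longrightarrow> (\<lambda>n. (f \<circ> q) (r n) x) \<longlonglongrightarrow> g x"
    then show ?thesis by (intro exI[of _ g] exI[of _ r]) simp
  qed (use f in auto)
  then obtain g r where "g holomorphic_on UNIV \<and> strict_mono (r :: nat \<Rightarrow> nat) \<and>
      (\<forall>x. (\<lambda>n. (f \<circ> q) (r n) x) \<longlonglongrightarrow> g x)" by (elim exE)
  then have g: "g holomorphic_on UNIV" and r: "strict_mono r"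
    and lim: "\<And>x. (\<lambda>n. (f \<circ> q) (r n) x) \<longlonglongrightarrow> g x" by auto
  have "g x - h x = 0" if "x \<in> \<real>" for x
  proof -
    from that obtain y where y: "x = of_real y" by (auto elim: Reals_cases)
    have "strict_mono (q \<circ> r)" using q(1) r by (rule strict_mono_o)
    from LIMSEQ_subseq_LIMSEQ[OF conv this, of y] lim[of x] have "g x = h x"
      by (auto simp: y o_def intro: LIMSEQ_unique)
    then show ?thesis by simp
  qed
  moreover have "(0 :: complex) islimpt \<real>"
    unfolding islimpt_approachable
  proof (intro allI impI)
    fix d :: real assume "d > 0"
    then show "\<exists>x'\<in>\<real>. x' \<noteq> (0::complex) \<and> dist x' 0 < d"
      by (intro bexI[of _ "of_real (d / 2)"]) auto
  qed
  ultimately have "g z - h z = 0"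
    using analytic_continuation[of "\<lambda>x. g x - h x" UNIV \<real> 0 z] g h
    by (auto intro: holomorphic_intros)
  with lim[of z] have "(\<lambda>n. f (q (r n)) z) \<longlonglongrightarrow> h z" by simp
  with e(1) have "\<forall>\<^sub>F n in sequentially. dist (f (q (r n)) z) (h z) < e"
    by (auto simp: tendsto_iff)
  then show False using q(2) by simp
qed

text \<open>The substitution \<open>u = x - \<i> y\<close>, \<open>v = x + \<i> y\<close> makes the antidiagonal \<open>u = cnj v\<close> the set of
  real pairs \<open>(x, y)\<close>.\<close>

lemma polarization_limit:
  fixes G :: "nat \<Rightarrow> complex \<Rightarrow> complex \<Rightarrow> complex"
  assumes G: "\<And>n \<alpha> \<beta> \<gamma> \<delta>. (\<lambda>x. G n (\<alpha> * x + \<beta>) (\<gamma> * x + \<delta>)) holomorphic_on UNIV"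
    and H: "\<And>\<alpha> \<beta> \<gamma> \<delta>. (\<lambda>x. H (\<alpha> * x + \<beta>) (\<gamma> * x + \<delta>)) holomorphic_on UNIV"
    and bound: "\<And>R. \<exists>B. \<forall>n u v. cmod u \<le> R \<longrightarrow> cmod v \<le> R \<longrightarrow> cmod (G n u v) \<le> B"
    and conv: "\<And>a. (\<lambda>n. G n (cnj a) a) \<longlonglongrightarrow> H (cnj a) a"
  shows "(\<lambda>n. G n u v) \<longlonglongrightarrow> H u v"
proof -
  have bound': "\<exists>B. \<forall>n x. cmod x \<le> R \<longrightarrow> cmod (G n (\<alpha> * x + \<beta>) (\<gamma> * x + \<delta>)) \<le> B" for R \<alpha> \<beta> \<gamma> \<delta>
  proof -
    define R' where "R' = max (cmod \<alpha> * R + cmod \<beta>) (cmod \<gamma> * R + cmod \<delta>)"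
    obtain B where B: "\<And>n u v. cmod u \<le> R' \<Longrightarrow> cmod v \<le> R' \<Longrightarrow> cmod (G n u v) \<le> B"
      using bound[of R'] by blast
    have "cmod (\<epsilon> * x + \<zeta>) \<le> cmod \<epsilon> * R + cmod \<zeta>" if "cmod x \<le> R" for x \<epsilon> \<zeta>
    proof -
      have "cmod (\<epsilon> * x + \<zeta>) \<le> cmod \<epsilon> * cmod x + cmod \<zeta>"
        using norm_triangle_ineq[of "\<epsilon> * x" \<zeta>] by (simp add: norm_mult)
      also have "\<dots> \<le> cmod \<epsilon> * R + cmod \<zeta>" using that by (simp add: mult_left_mono)
      finally show ?thesis .
    qed
    then have "cmod (G n (\<alpha> * x + \<beta>) (\<gamma> * x + \<delta>)) \<le> B" if "cmod x \<le> R" for n x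
      by (intro B) (auto simp: R'_def le_max_iff_disj that)
    then show ?thesis by blast
  qed
  \<comment> \<open>One variable at a time: here y stays real while x becomes complex;
    \<open>2\<close> then fixes a complex x and frees y. Each use of Vitali's theorem meets affine
    functions of a single variable in the two slots, which is why holomorphy is assumed along such
    lines.\<close>
  have 1: "(\<lambda>n. G n (x - \<i> * of_real y) (x + \<i> * of_real y)) \<longlonglongrightarrow> H (x - \<i> * of_real y) (x + \<i> * of_real y)" for x y
  proof (rule Vitali_entire[of "\<lambda>n x. G n (x - \<i> * of_real y) (x + \<i> * of_real y)" "\<lambda>x. H (x - \<i> * of_real y) (x + \<i> * of_real y)"])
    show "(\<lambda>x. G n (x - \<i> * of_real y) (x + \<i> * of_real y)) holomorphic_on UNIV" for n
      using G[of n 1 "- \<i> * of_real y" 1 "\<i> * of_real y"] by simp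
    show "(\<lambda>x. H (x - \<i> * of_real y) (x + \<i> * of_real y)) holomorphic_on UNIV"
      using H[of 1 "- \<i> * of_real y" 1 "\<i> * of_real y"] by simp
    show "\<exists>B. \<forall>n x. cmod x \<le> R \<longrightarrow> cmod (G n (x - \<i> * of_real y) (x + \<i> * of_real y)) \<le> B" for R
      using bound'[of R 1 "- \<i> * of_real y" 1 "\<i> * of_real y"] by simp
    show "(\<lambda>n. G n (of_real x - \<i> * of_real y) (of_real x + \<i> * of_real y)) \<longlonglongrightarrow>
        H (of_real x - \<i> * of_real y) (of_real x + \<i> * of_real y)" for x
      using conv[of "of_real x + \<i> * of_real y"] by simp
  qed
  have 2: "(\<lambda>n. G n (x - \<i> * y) (x + \<i> * y)) \<longlonglongrightarrow> H (x - \<i> * y) (x + \<i> * y)" for x y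
  proof (rule Vitali_entire[of "\<lambda>n y. G n (x - \<i> * y) (x + \<i> * y)" "\<lambda>y. H (x - \<i> * y) (x + \<i> * y)"])
    show "(\<lambda>y. G n (x - \<i> * y) (x + \<i> * y)) holomorphic_on UNIV" for n
      using G[of n "- \<i>" x \<i> x] by (simp add: add.commute)
    show "(\<lambda>y. H (x - \<i> * y) (x + \<i> * y)) holomorphic_on UNIV"
      using H[of "- \<i>" x \<i> x] by (simp add: add.commute)
    show "\<exists>B. \<forall>n y. cmod y \<le> R \<longrightarrow> cmod (G n (x - \<i> * y) (x + \<i> * y)) \<le> B" for R
      using bound'[of R "- \<i>" x \<i> x] by (simp add: add.commute)
    show "(\<lambda>n. G n (x - \<i> * of_real y) (x + \<i> * of_real y)) \<longlonglongrightarrow> H (x - \<i> * of_real y) (x + \<i> * of_real y)" for y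
      by (rule 1)
  qed
  have "(u + v) / 2 - \<i> * ((v - u) / (2 * \<i>)) = u" "(u + v) / 2 + \<i> * ((v - u) / (2 * \<i>)) = v"
    by (simp_all add: field_simps)
  with 2[of "(u + v) / 2" "(v - u) / (2 * \<i>)"] show ?thesis by simp
qed

section \<open>The complementary error function\<close>

lemma integrable_exp_square_shift:
  "integrable lborel (\<lambda>s. exp (- (z + complex_of_real s)\<^sup>2))"
proof -
  have "integrable lborel (\<lambda>s::real. exp (- 1 * s\<^sup>2))"
    using lborel_gaussian_real[of 1] by (intro integrableI_nonneg) auto
  then have "integrable lborel (\<lambda>s. exp (- (Re z + 1 * s)\<^sup>2))"
    using lborel_integrable_real_affine[of "\<lambda>s::real. exp (- 1 * s\<^sup>2)" 1 "Re z"] by simp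
  then have "integrable lborel (\<lambda>s. exp ((Im z)\<^sup>2) * exp (- (Re z + s)\<^sup>2))"
    by simp
  then show ?thesis
  proof (rule Bochner_Integration.integrable_bound)
    show "(\<lambda>s. exp (- (z + complex_of_real s)\<^sup>2)) \<in> borel_measurable lborel"
      by measurable
  qed (auto simp: exp_add[symmetric] power2_eq_square algebra_simps)
qed

text \<open>The ray of integration moves with z, so holomorphy is obtained by comparison with a
  primitive E. The integral is the limit of \<open>E (z + N) - E z\<close> for real N tending to
  infinity. Since \<open>E (z + N) - E N\<close> tends to 0, the integral plus \<open>E z\<close>
  does not depend on z.\<close>

lemma erfc_primitive:
  "\<exists>E c. (\<forall>z. (E has_field_derivative exp (- z\<^sup>2)) (at z)) \<and>
     (\<forall>z. erfc z = of_real (2 / sqrt pi) * (c - E z))"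
proof -
  have "(\<lambda>z::complex. exp (- z\<^sup>2)) holomorphic_on UNIV" by (intro holomorphic_intros)
  then obtain E :: "complex \<Rightarrow> complex" where "\<forall>z. (E has_field_derivative exp (- z\<^sup>2)) (at z)"
    by (rule holomorphic_convex_primitive'[rotated 2]) auto
  then have E: "(E has_field_derivative exp (- z\<^sup>2)) (at z)" for z by simp
  define J where "J = (\<lambda>z::complex. LINT s:{0..}|lborel. exp (- (z + of_real s)\<^sup>2))"
  have lim: "((\<lambda>N. E (z + of_real N) - E z) \<longlongrightarrow> J z) at_top" for z
  proof -
    have "((\<lambda>N. LINT s:{0..N}|lborel. exp (- (z + of_real s)\<^sup>2)) \<longlongrightarrow> J z) at_top"
      unfolding J_def
    proof (rule tendsto_set_lebesgue_integral_at_top)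
      show "set_integrable lborel {0..} (\<lambda>s. exp (- (z + complex_of_real s)\<^sup>2))"
        unfolding set_integrable_def
        using integrable_mult_indicator[OF _ integrable_exp_square_shift[of z], of "{0..}"] by simp
    qed auto
    moreover have "\<forall>\<^sub>F N in at_top. (LINT s:{0..N}|lborel. exp (- (z + of_real s)\<^sup>2)) = E (z + of_real N) - E z"
      using eventually_ge_at_top[of "0::real"]
    proof eventually_elim
      case (elim N)
      have "(LINT s:{0..N}|lborel. exp (- (z + of_real s)\<^sup>2)) = E (z + of_real N) - E (z + of_real 0)"
        unfolding set_lebesgue_integral_def
      proof (rule integral_FTC_atLeastAtMost[OF elim])
        fix s :: real
        have "((\<lambda>s. z + of_real s) has_vector_derivative 1) (at s within {0..N})"
          unfolding has_vector_derivative_def by (auto intro!: derivative_eq_intros simp: scaleR_conv_of_real)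
        then show "((\<lambda>s. E (z + of_real s)) has_vector_derivative exp (- (z + of_real s)\<^sup>2)) (at s within {0..N})"
          using field_vector_diff_chain_within[of "\<lambda>s. z + of_real s" 1 s "{0..N}" E]
            has_field_derivative_at_within[OF E] by (simp add: o_def)
      qed (intro continuous_intros)
      then show ?case by simp
    qed
    ultimately show ?thesis by (rule Lim_transform_eventually)
  qed
  have "J z + E z = J 0 + E 0" for z
  proof -
    define c where "c = cmod z"
    have c: "c \<ge> 0" by (simp add: c_def)
    have "((\<lambda>N. E (z + of_real N) - E (of_real N)) \<longlongrightarrow> 0) at_top"
    proof (rule Lim_null_comparison)
      show "((\<lambda>N. exp (c\<^sup>2 - (N - c)\<^sup>2) * c) \<longlongrightarrow> 0) at_top" by real_asymp
      show "\<forall>\<^sub>F N in at_top. norm (E (z + of_real N) - E (of_real N)) \<le> exp (c\<^sup>2 - (N - c)\<^sup>2) * c"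
        using eventually_ge_at_top[of c]
      proof eventually_elim
        case (elim N)
        \<comment> \<open>Both N and z + N lie in this disc, where the real part is at least N - c
          and the imaginary part is at most c in modulus, so the derivative of E is tiny on
          it.\<close>
        have b: "cmod (exp (- w\<^sup>2)) \<le> exp (c\<^sup>2 - (N - c)\<^sup>2)" if "w \<in> cball (of_real N) c" for w
        proof -
          have d: "cmod (w - of_real N) \<le> c" using that by (simp add: dist_norm norm_minus_commute)
          have "\<bar>Re w - N\<bar> \<le> c" "\<bar>Im w\<bar> \<le> c"
            using abs_Re_le_cmod[of "w - of_real N"] abs_Im_le_cmod[of "w - of_real N"] d by auto
          then have "(Im w)\<^sup>2 \<le> c\<^sup>2" "(N - c)\<^sup>2 \<le> (Re w)\<^sup>2"
            using elim abs_le_square_iff[of "Im w" c] by (auto intro!: power_mono)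
          then show ?thesis by (simp add: power2_eq_square)
        qed
        have "norm (E (z + of_real N) - E (of_real N)) \<le> exp (c\<^sup>2 - (N - c)\<^sup>2) * norm (z + of_real N - of_real N)"
          by (rule field_differentiable_bound[of "cball (of_real N) c" E "\<lambda>w. exp (- w\<^sup>2)"])
             (use b E c in \<open>auto simp: c_def dist_norm intro: has_field_derivative_at_within\<close>)
        then show ?case by (simp add: c_def)
      qed
    qed
    moreover have "((\<lambda>N. (E (z + of_real N) - E z) - (E (0 + of_real N) - E 0)) \<longlongrightarrow> J z - J 0) at_top"
      by (intro tendsto_diff lim)
    then have "((\<lambda>N. (E (z + of_real N) - E z) - (E (0 + of_real N) - E 0) + (E z - E 0)) \<longlongrightarrow> J z - J 0 + (E z - E 0)) at_top"
      by (rule tendsto_add) (rule tendsto_const)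
    then have "((\<lambda>N. E (z + of_real N) - E (of_real N)) \<longlongrightarrow> J z - J 0 + (E z - E 0)) at_top"
      by (simp add: algebra_simps)
    ultimately have "J z - J 0 + (E z - E 0) = 0"
      by (intro tendsto_unique[OF _ _ \<open>(_ \<longlongrightarrow> 0) at_top\<close>]) auto
    then show ?thesis by (simp add: algebra_simps)
  qed
  then have "J z = J 0 + E 0 - E z" for z by (metis add_diff_cancel_right')
  then have "erfc z = of_real (2 / sqrt pi) * (J 0 + E 0 - E z)" for z
    by (simp add: erfc_def J_def)
  with E show ?thesis by blast
qed

lemma holomorphic_on_erfc: "f holomorphic_on S \<Longrightarrow> (\<lambda>z. erfc (f z)) holomorphic_on S"
proof -
  assume f: "f holomorphic_on S"
  obtain E c where "\<forall>z. (E has_field_derivative exp (- z\<^sup>2)) (at z)"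
    "\<forall>z. erfc z = of_real (2 / sqrt pi) * (c - E z)" using erfc_primitive by blast
  then have eq: "erfc = (\<lambda>z. of_real (2 / sqrt pi) * (c - E z))" and E: "E holomorphic_on UNIV"
    by (auto simp: holomorphic_on_open)
  have "erfc holomorphic_on UNIV" unfolding eq by (intro holomorphic_intros E)
  then show ?thesis
    using holomorphic_on_compose_gen[OF f, of erfc UNIV] by (simp add: o_def)
qed

text \<open>The substitution \<open>y = - sqrt 2 * (x + s)\<close> maps the ray s >= 0 onto the
  lower tail of the standard normal law, the form in which the central limit theorem delivers its
  limit.\<close>

lemma erfc_of_real:
  "erfc (of_real x) = of_real (2 * cdf std_normal_distribution (- (sqrt 2 * x)))"
proof -
  let ?I = "LINT s|lborel. indicator {0..} s * exp (- (x + s)\<^sup>2)"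
  have "cdf std_normal_distribution (- (sqrt 2 * x)) =
      (LINT y|std_normal_distribution. indicator {..- (sqrt 2 * x)} y)"
    by (simp add: cdf_def)
  also have "\<dots> = (LINT y|lborel. std_normal_density y * indicator {..- (sqrt 2 * x)} y)"
    by (subst integral_density) auto
  also have "\<dots> = sqrt 2 * (LINT s|lborel. std_normal_density (- (sqrt 2 * x) + - sqrt 2 * s)
      * indicator {..- (sqrt 2 * x)} (- (sqrt 2 * x) + - sqrt 2 * s))"
    by (subst lborel_integral_real_affine[where c = "- sqrt 2" and t = "- (sqrt 2 * x)"]) auto
  also have "(\<lambda>s. std_normal_density (- (sqrt 2 * x) + - sqrt 2 * s)
      * indicator {..- (sqrt 2 * x)} (- (sqrt 2 * x) + - sqrt 2 * s)) =
      (\<lambda>s. 1 / sqrt (2 * pi) * (indicator {0..} s * exp (- (x + s)\<^sup>2)))"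
  proof
    fix s
    have "(- (sqrt 2 * x) + - sqrt 2 * s)\<^sup>2 / 2 = (x + s)\<^sup>2"
    proof -
      have "- (sqrt 2 * x) + - sqrt 2 * s = - (sqrt 2 * (x + s))" by (simp add: algebra_simps)
      then show ?thesis by (simp add: power_mult_distrib)
    qed
    moreover have "(indicator {..- (sqrt 2 * x)} (- (sqrt 2 * x) + - sqrt 2 * s) :: real) = indicator {0..} s"
      by (auto simp: indicator_def zero_le_mult_iff)
    ultimately show "std_normal_density (- (sqrt 2 * x) + - sqrt 2 * s)
      * indicator {..- (sqrt 2 * x)} (- (sqrt 2 * x) + - sqrt 2 * s) =
        1 / sqrt (2 * pi) * (indicator {0..} s * exp (- (x + s)\<^sup>2))"
      unfolding std_normal_density_def minus_divide_left[symmetric] by simp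
  qed
  finally have c: "2 * cdf std_normal_distribution (- (sqrt 2 * x)) = 2 / sqrt pi * ?I"
    by (simp add: real_sqrt_mult)
  have "(LINT s:{0..}|lborel. exp (- (of_real x + complex_of_real s)\<^sup>2)) =
      (LINT s|lborel. complex_of_real (indicator {0..} s * exp (- (x + s)\<^sup>2)))"
    unfolding set_lebesgue_integral_def
    by (intro Bochner_Integration.integral_cong) (auto simp: scaleR_conv_of_real exp_of_real[symmetric])
  also have "\<dots> = complex_of_real ?I" by (rule integral_complex_of_real)
  finally show ?thesis
    unfolding c erfc_def by simp
qed

section \<open>Ladder operators\<close>

text \<open>The family is triangular against the monomials: subtracting the multiple of
  \<open>p l\<close> that cancels the leading coefficient lowers the degree.\<close>

lemma poly_span_induct [consumes 3, case_names zero add]: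
  fixes p :: "nat \<Rightarrow> 'a::field poly"
  assumes deg: "\<And>k. degree (p k) = k" "\<And>k. p k \<noteq> 0" and f: "f = 0 \<or> degree f < m"
    and zero: "P 0" and add: "\<And>f a k. k < m \<Longrightarrow> P f \<Longrightarrow> P (f + smult a (p k))"
  shows "P f"
proof -
  have "P f" if "f = 0 \<or> degree f < l" "l \<le> m" for f l
    using that
  proof (induction l arbitrary: f)
    case 0
    then show ?case using zero by auto
  next
    case (Suc l)
    show ?case
    proof (cases "f = 0 \<or> degree f < l")
      case True
      then show ?thesis using Suc by auto
    next
      case False
      then have d: "degree f = l" "f \<noteq> 0" using Suc by auto
      define a where "a = lead_coeff f / lead_coeff (p l)"
      have "lead_coeff (p l) \<noteq> 0" using deg(2) by simp
      then have c: "coeff (f - smult a (p l)) l = 0"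
        by (simp add: a_def deg d)
      have "degree (f - smult a (p l)) \<le> l"
        by (rule degree_diff_le) (auto simp: d deg)
      then have "f - smult a (p l) = 0 \<or> degree (f - smult a (p l)) < l"
        using c by (metis leading_coeff_0_iff le_neq_implies_less)
      then have "P (f - smult a (p l))" using Suc by simp
      then have "P (f - smult a (p l) + smult a (p l))"
        using Suc by (intro add) auto
      then show ?thesis by simp
    qed
  qed
  then show ?thesis using f by blast
qed

section \<open>The elliptic weight and its inner product\<close>

lemma elliptic_potential_eq:
  "elliptic_potential t z = (1 - t) * (Re z)\<^sup>2 + (1 + t) * (Im z)\<^sup>2"
  unfolding elliptic_potential_def cmod_power2 by (simp add: algebra_simps power2_eq_square)

lemma has_vector_derivative_poly_line:
  fixes f :: "complex poly"
  shows
  "((\<lambda>s. poly f (z + of_real s * e)) has_vector_derivative e * poly (pderiv f) (z + of_real s * e)) (at s)"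
proof -
  have "((\<lambda>s. z + of_real s * e) has_vector_derivative e) (at s)"
    unfolding has_vector_derivative_def scaleR_conv_of_real[symmetric]
    by (auto intro!: derivative_eq_intros)
  moreover have "(poly f has_field_derivative poly (pderiv f) (z + of_real s * e)) (at (z + of_real s * e))"
    by (rule poly_DERIV)
  ultimately show ?thesis
    using field_vector_diff_chain_at[of "\<lambda>s. z + of_real s * e" e s "poly f"] by (simp add: o_def)
qed

locale elliptic_orthonormal =
  fixes t :: real and n :: nat and p :: "nat \<Rightarrow> complex poly"
  assumes t: "0 < t" "t < 1" and n: "n \<ge> 1"
    and orth: "orthonormal_polys (elliptic_potential t) n p"
begin

definition weight :: "complex \<Rightarrow> real" where
  "weight z = exp (- real n * elliptic_potential t z)"

definition wprod :: "complex poly \<Rightarrow> complex poly \<Rightarrow> complex \<Rightarrow> complex" where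
  "wprod f g z = cnj (poly f z) * poly g z * of_real (weight z)"

definition ip :: "complex poly \<Rightarrow> complex poly \<Rightarrow> complex" where
  "ip f g = (LINT z|lborel. wprod f g z)"

text \<open>The commutator of differentiation with its adjoint \<open>raising\<close> is
  multiplication by this constant.\<close>

definition \<kappa> :: real where "\<kappa> = real n * (1 - t\<^sup>2)"

lemma \<kappa>_pos: "\<kappa> > 0"
  using t n by (simp add: \<kappa>_def power_less_one_iff)

lemma degree_p: "degree (p k) = k"
  using orth by (simp add: orthonormal_polys_def)

lemma lead_coeff_p: obtains c where "c > 0" "lead_coeff (p k) = complex_of_real c"
  using orth unfolding orthonormal_polys_def by blast

lemma p_nonzero: "p k \<noteq> 0"
  using lead_coeff_p[of k] by fastforce

lemma has_bochner_integral_p: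
  "has_bochner_integral lborel (wprod (p k) (p l)) (if k = l then 1 else 0)"
  using orth unfolding orthonormal_polys_def wprod_def[abs_def] weight_def by blast

lemma wprod_simps:
  "wprod 0 g z = 0" "wprod f 0 z = 0"
  "wprod (f + f') g z = wprod f g z + wprod f' g z" "wprod f (g + g') z = wprod f g z + wprod f g' z"
  "wprod f (g - g') z = wprod f g z - wprod f g' z"
  "wprod (smult a f) g z = cnj a * wprod f g z" "wprod f (smult a g) z = a * wprod f g z"
  by (simp_all add: wprod_def algebra_simps)

lemma p_induct [case_names zero add]:
  assumes "P 0" "\<And>f a k. P f \<Longrightarrow> P (f + smult a (p k))"
  shows "P f"
  using poly_span_induct[OF degree_p p_nonzero, of f "Suc (degree f)" P] assms by blast

lemma integrable_wprod [simp]: "integrable lborel (wprod f g)"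
proof (induction g rule: p_induct)
  case (add g a l)
  have "integrable lborel (wprod f (p l))"
  proof (induction f rule: p_induct)
    case (add f b k)
    have "integrable lborel (wprod (p k) (p l))"
      using has_bochner_integral_p by (auto simp: has_bochner_integral_iff)
    then show ?case using add by (simp add: wprod_simps[abs_def])
  qed (simp add: wprod_simps[abs_def])
  then show ?case using add by (simp add: wprod_simps[abs_def])
qed (simp add: wprod_simps[abs_def])

lemma ip_simps:
  "ip 0 g = 0" "ip f 0 = 0"
  "ip (f + f') g = ip f g + ip f' g" "ip f (g + g') = ip f g + ip f g'"
  "ip f (g - g') = ip f g - ip f g'"
  "ip (smult a f) g = cnj a * ip f g" "ip f (smult a g) = a * ip f g"
  by (simp_all add: ip_def wprod_simps)

lemma ip_cnj: "ip g f = cnj (ip f g)"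
proof -
  have "wprod g f z = cnj (wprod f g z)" for z
    by (simp add: wprod_def)
  then show ?thesis by (simp add: ip_def)
qed

lemma ip_p: "ip (p k) (p l) = (if k = l then 1 else 0)"
  unfolding ip_def by (rule has_bochner_integral_integral_eq[OF has_bochner_integral_p])

lemma ip_p_lower:
  assumes "degree f < k \<or> f = 0"
  shows "ip f (p k) = 0" "ip (p k) f = 0"
proof -
  have "f = 0 \<or> degree f < k" using assms by blast
  then show "ip f (p k) = 0"
    by (rule poly_span_induct[of p f k "\<lambda>f. ip f (p k) = 0", OF degree_p p_nonzero])
       (auto simp: ip_simps ip_p)
  then show "ip (p k) f = 0" by (simp add: ip_cnj[of "p k" f])
qed

text \<open>Pairing with \<open>p m\<close> reads off the top coefficient of r, because what remains
  has lower degree and is orthogonal to \<open>p m\<close>; so the degree bound can be lowered step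
  by step.\<close>

lemma eq_0_if_orthogonal:
  assumes "r = 0 \<or> degree r < m" "\<And>j. j < m \<Longrightarrow> ip (p j) r = 0"
  shows "r = 0"
  using assms
proof (induction m)
  case (Suc m)
  show ?case
  proof (cases "r = 0 \<or> degree r < m")
    case True
    then show ?thesis using Suc by auto
  next
    case False
    then have d: "degree r = m" "r \<noteq> 0" using Suc by auto
    define a where "a = lead_coeff r / lead_coeff (p m)"
    define r' where "r' = r - smult a (p m)"
    have "lead_coeff (p m) \<noteq> 0" using p_nonzero by simp
    then have c: "coeff r' m = 0"
      by (simp add: a_def r'_def degree_p d)
    have "degree r' \<le> m"
      unfolding r'_def by (rule degree_diff_le) (auto simp: d degree_p)
    then have "r' = 0 \<or> degree r' < m"
      using c by (metis leading_coeff_0_iff le_neq_implies_less)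
    then have "ip (p m) r' = 0" using ip_p_lower by blast
    moreover have "r = smult a (p m) + r'" by (simp add: r'_def)
    then have "ip (p m) r = a + ip (p m) r'" by (simp add: ip_simps ip_p)
    moreover have "ip (p m) r = 0" using Suc.prems by simp
    ultimately have "a = 0" by simp
    then show ?thesis using d(2) p_nonzero by (simp add: a_def)
  qed
qed auto

text \<open>The derivative of \<open>wprod f g\<close> in direction e integrates to 0.
  \<open>pCons 0\<close> is multiplication by z; in the conjugated slot it stands for
  \<open>cnj z\<close>, so the derivative of the weight, expressed through z and
  \<open>cnj z\<close>, turns into inner products of polynomials.\<close>

lemma ip_directional:
  "cnj e * ip (pderiv f) g + e * ip f (pderiv g)
   - of_real (real n * (1 - t) * Re e) * (ip f (pCons 0 g) + ip (pCons 0 f) g)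
   + \<i> * of_real (real n * (1 + t) * Im e) * (ip f (pCons 0 g) - ip (pCons 0 f) g) = 0"
proof -
  define h' where "h' = (\<lambda>z. cnj e * wprod (pderiv f) g z + e * wprod f (pderiv g) z
   - of_real (real n * (1 - t) * Re e) * (wprod f (pCons 0 g) z + wprod (pCons 0 f) g z)
   + \<i> * of_real (real n * (1 + t) * Im e) * (wprod f (pCons 0 g) z - wprod (pCons 0 f) g z))"
  have "(LINT z|lborel. h' z) = 0"
  proof (rule integral_directional_derivative_eq_0[of "wprod f g" e])
    fix z s
    let ?z = "z + s *\<^sub>R e"
    have W: "((\<lambda>s. weight (z + s *\<^sub>R e)) has_real_derivative
        - real n * (2 * (1 - t) * Re ?z * Re e + 2 * (1 + t) * Im ?z * Im e) * weight ?z) (at s)"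
      unfolding weight_def elliptic_potential_eq
      by (auto intro!: derivative_eq_intros simp: algebra_simps)
    have "((\<lambda>s. wprod f g (z + s *\<^sub>R e)) has_vector_derivative
       cnj (poly f ?z) * poly g ?z * of_real (- real n * (2 * (1 - t) * Re ?z * Re e + 2 * (1 + t) * Im ?z * Im e) * weight ?z)
       + (cnj (poly f ?z) * (e * poly (pderiv g) ?z) + cnj (e * poly (pderiv f) ?z) * poly g ?z) * weight ?z) (at s)"
      unfolding wprod_def
      by (rule has_vector_derivative_mult[OF has_vector_derivative_mult[OF has_vector_derivative_cnj
            [OF has_vector_derivative_poly_line[of f z e s, folded scaleR_conv_of_real]]
            has_vector_derivative_poly_line[of g z e s, folded scaleR_conv_of_real]]
            has_vector_derivative_of_real[OF W]])
    moreover have "cnj (poly f ?z) * poly g ?z * of_real (- real n * (2 * (1 - t) * Re ?z * Re e + 2 * (1 + t) * Im ?z * Im e) * weight ?z)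
       + (cnj (poly f ?z) * (e * poly (pderiv g) ?z) + cnj (e * poly (pderiv f) ?z) * poly g ?z) * weight ?z
       = h' ?z"
    proof -
      define w where "w = ?z"
      have 1: "2 * of_real (Re w) = w + cnj w" "2 * of_real (Im w) = - \<i> * (w - cnj w)"
        by (simp_all add: complex_eq_iff)
      have "of_real (2 * (1 - t) * Re w * Re e + 2 * (1 + t) * Im w * Im e)
         = of_real (1 - t) * of_real (Re e) * (2 * complex_of_real (Re w)) + of_real (1 + t) * of_real (Im e) * (2 * complex_of_real (Im w))"
        by (simp add: algebra_simps)
      then have 2: "complex_of_real (2 * (1 - t) * Re w * Re e + 2 * (1 + t) * Im w * Im e) = of_real (1 - t) * of_real (Re e) * (w + cnj w) + of_real (1 + t) * of_real (Im e) * (- \<i> * (w - cnj w))"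
        unfolding 1 .
      show ?thesis
        unfolding h'_def wprod_def w_def[symmetric] of_real_mult[of "_ * _" "weight _"] of_real_mult[of "- real n"] 2
        by (simp add: algebra_simps)
    qed
    ultimately show "((\<lambda>s. wprod f g (z + s *\<^sub>R e)) has_vector_derivative h' ?z) (at s)" by simp
  next
    show "integrable lborel h'" by (simp add: h'_def)
    show "continuous_on UNIV h'"
      unfolding h'_def wprod_def weight_def elliptic_potential_eq by (intro continuous_intros)
  qed simp
  then show ?thesis
    by (simp add: h'_def ip_def)
qed

definition raising :: "complex poly \<Rightarrow> complex poly" where
  "raising g = smult (of_real \<kappa>) (pCons 0 g) - smult (of_real t) (pderiv g)"

text \<open>The adjoint of differentiation sends polynomials to polynomials because
  \<open>cnj z\<close> can be eliminated: the directions 1 and \<i> give two identities, and the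
  combination below cancels \<open>Y\<close>, the only term with a multiplication in the conjugated
  slot.\<close>

lemma ip_raising: "ip (pderiv f) g = ip f (raising g)"
proof -
  define A B Z Y N T where "A = ip (pderiv f) g" "B = ip f (pderiv g)" "Z = ip f (pCons 0 g)"
    "Y = ip (pCons 0 f) g" "N = complex_of_real (real n)" "T = complex_of_real t"
  have 1: "A + B - N * (1 - T) * (Z + Y) = 0"
    using ip_directional[of 1 f g] by (simp add: A_B_Z_Y_N_T_def)
  have 2: "\<i> * (- A + B + N * (1 + T) * (Z - Y)) = 0"
    using ip_directional[of \<i> f g] by (simp add: A_B_Z_Y_N_T_def algebra_simps)
  then have 2: "- A + B + N * (1 + T) * (Z - Y) = 0" by simp
  have "2 * (A + T * B - N * (1 - T\<^sup>2) * Z) =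
     (1 + T) * (A + B - N * (1 - T) * (Z + Y)) - (1 - T) * (- A + B + N * (1 + T) * (Z - Y))"
    by (simp add: algebra_simps power2_eq_square)
  then have "A + T * B - N * (1 - T\<^sup>2) * Z = 0"
    unfolding 1 2 by (simp only: mult_zero_right diff_zero mult_eq_0_iff) simp
  then show ?thesis
    by (simp add: raising_def ip_simps A_B_Z_Y_N_T_def \<kappa>_def algebra_simps del: smult_pCons)
qed

lemma coeff_raising_Suc: "degree g = k \<Longrightarrow> coeff (raising g) (Suc k) = of_real \<kappa> * lead_coeff g"
  by (simp add: raising_def coeff_pderiv coeff_eq_0)

lemma degree_raising_le: "degree (raising g) \<le> Suc (degree g)"
  unfolding raising_def
  by (intro degree_diff_le order.trans[OF degree_smult_le] order.trans[OF degree_pCons_le])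
     (auto simp: degree_pderiv)

lemma eq_smult_p:
  assumes "degree g \<le> m" and "\<And>j. j < m \<Longrightarrow> ip (p j) g = 0"
  shows "g = smult (coeff g m / lead_coeff (p m)) (p m)"
proof -
  define a where "a = coeff g m / lead_coeff (p m)"
  define r where "r = g - smult a (p m)"
  have "lead_coeff (p m) \<noteq> 0" using p_nonzero by simp
  then have c: "coeff r m = 0"
    by (simp add: a_def r_def degree_p)
  have "degree r \<le> m"
    unfolding r_def by (rule degree_diff_le) (auto simp: assms degree_p)
  then have "r = 0 \<or> degree r < m"
    using c by (metis leading_coeff_0_iff le_neq_implies_less)
  then have "r = 0"
    by (rule eq_0_if_orthogonal) (use assms in \<open>auto simp: r_def ip_simps ip_p\<close>)
  then show ?thesis by (simp add: r_def a_def)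
qed

text \<open>By adjointness and a count of degrees, each image is orthogonal to all
  \<open>p j\<close> below its degree, hence a multiple of a single one. In terms of the leading
  coefficients a and b the two factors are \<open>\<kappa> * a / b\<close> and
  \<open>Suc k * b / a\<close>. Adjointness makes them equal, their product is
  \<open>\<kappa> * Suc k\<close>, and positivity of a and b selects the positive root.\<close>

lemma ladder:
  "raising (p k) = smult (of_real (sqrt (\<kappa> * Suc k))) (p (Suc k))"
  "pderiv (p (Suc k)) = smult (of_real (sqrt (\<kappa> * Suc k))) (p k)"
proof -
  obtain a where a: "a > 0" "lead_coeff (p k) = of_real a" by (rule lead_coeff_p)
  obtain b where b: "b > 0" "lead_coeff (p (Suc k)) = of_real b" by (rule lead_coeff_p)
  have "raising (p k) = smult (coeff (raising (p k)) (Suc k) / lead_coeff (p (Suc k))) (p (Suc k))"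
  proof (rule eq_smult_p)
    show "degree (raising (p k)) \<le> Suc k" using degree_raising_le[of "p k"] by (simp add: degree_p)
    show "ip (p j) (raising (p k)) = 0" if "j < Suc k" for j
    proof -
      have "degree (pderiv (p j)) < k \<or> pderiv (p j) = 0"
        using that by (cases j) (auto simp: degree_pderiv degree_p pderiv_eq_0_iff)
      then show ?thesis using ip_p_lower by (simp add: ip_raising[symmetric])
    qed
  qed
  then have R: "raising (p k) = smult (of_real (\<kappa> * a / b)) (p (Suc k))"
    using coeff_raising_Suc[OF degree_p] a b by (simp add: degree_p)
  have "pderiv (p (Suc k)) = smult (coeff (pderiv (p (Suc k))) k / lead_coeff (p k)) (p k)"
  proof (rule eq_smult_p)
    show "degree (pderiv (p (Suc k))) \<le> k" by (simp add: degree_pderiv degree_p)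
    show "ip (p j) (pderiv (p (Suc k))) = 0" if "j < k" for j
    proof -
      have "degree (raising (p j)) < Suc k"
        using degree_raising_le[of "p j"] that by (simp add: degree_p)
      then show ?thesis
        using ip_p_lower by (simp add: ip_cnj[of "p j"] ip_raising)
    qed
  qed
  then have D: "pderiv (p (Suc k)) = smult (of_real (Suc k * b / a)) (p k)"
    using a b by (simp add: coeff_pderiv degree_p)
  have "of_real (Suc k * b / a) = ip (pderiv (p (Suc k))) (p k)"
    unfolding D by (simp add: ip_simps ip_p)
  also have "\<dots> = of_real (\<kappa> * a / b)"
    unfolding ip_raising R by (simp add: ip_simps ip_p)
  finally have eq: "Suc k * b / a = \<kappa> * a / b" by (simp only: of_real_eq_iff)
  have "(\<kappa> * a / b) * (\<kappa> * a / b) = (\<kappa> * a / b) * (Suc k * b / a)" unfolding eq ..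
  also have "\<dots> = \<kappa> * Suc k" using a b by simp
  finally have "sqrt (\<kappa> * Suc k) = \<kappa> * a / b"
    using a b \<kappa>_pos by (intro real_sqrt_unique) (auto simp: power2_eq_square)
  then show "raising (p k) = smult (of_real (sqrt (\<kappa> * Suc k))) (p (Suc k))"
    "pderiv (p (Suc k)) = smult (of_real (sqrt (\<kappa> * Suc k))) (p k)"
    using R D unfolding eq by simp_all
qed

lemma p_0: "p 0 = [:of_real (sqrt (real n * sqrt (1 - t\<^sup>2) / pi)):]"
proof -
  obtain a where a: "a > 0" "lead_coeff (p 0) = of_real a" by (rule lead_coeff_p)
  then have p0: "p 0 = [:of_real a:]"
    using degree_p[of 0] by (metis degree_0_id degree_p)
  have "1 = ip (p 0) (p 0)" by (simp add: ip_p)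
  also have "\<dots> = (LINT z|lborel. complex_of_real (a\<^sup>2 * exp (- (real n * (1 - t) * (Re z)\<^sup>2 + real n * (1 + t) * (Im z)\<^sup>2))))"
    unfolding ip_def wprod_def p0 weight_def elliptic_potential_eq
    by (intro Bochner_Integration.integral_cong) (auto simp: power2_eq_square algebra_simps)
  also have "\<dots> = complex_of_real (a\<^sup>2 * (pi / sqrt (real n * (1 - t) * (real n * (1 + t)))))"
    using lborel_gaussian_complex[of "real n * (1 - t)" "real n * (1 + t)"] t n by simp
  also have "real n * (1 - t) * (real n * (1 + t)) = (real n)\<^sup>2 * (1 - t\<^sup>2)"
    by (simp add: power2_eq_square algebra_simps)
  finally have "complex_of_real 1 = complex_of_real (a\<^sup>2 * (pi / (n * sqrt (1 - t\<^sup>2))))"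
    by (simp add: real_sqrt_mult)
  then have "1 = a\<^sup>2 * (pi / (n * sqrt (1 - t\<^sup>2)))"
    by (simp only: of_real_eq_iff)
  moreover have "sqrt (1 - t\<^sup>2) > 0" using t by (simp add: power_less_one_iff)
  ultimately have "a\<^sup>2 = real n * sqrt (1 - t\<^sup>2) / pi"
    using n by (simp add: field_simps)
  then have "a = sqrt (real n * sqrt (1 - t\<^sup>2) / pi)"
    using a by (metis real_sqrt_abs abs_of_pos)
  then show ?thesis using p0 by simp
qed

end

section \<open>Mehler's formula\<close>

context elliptic_orthonormal
begin

text \<open>At k = 0 the truncated \<open>k - 1\<close> is again 0, but the factor
  \<open>sqrt (\<kappa> * k)\<close> vanishes, so one formula covers every index.\<close>

lemma DERIV_poly_p:
  "(poly (p k) has_field_derivative of_real (sqrt (\<kappa> * k)) * poly (p (k - 1)) z) (at z)"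
proof (cases k)
  case 0
  have "poly (p 0) = (\<lambda>_. of_real (sqrt (real n * sqrt (1 - t\<^sup>2) / pi)))"
    by (simp add: p_0 fun_eq_iff)
  then show ?thesis using 0 by simp
next
  case (Suc j)
  then show ?thesis using poly_DERIV[of "p k" z] ladder(2)[of j] by simp
qed

lemma poly_p_recurrence:
  "of_real (sqrt (\<kappa> * Suc k)) * poly (p (Suc k)) z =
     of_real \<kappa> * z * poly (p k) z - of_real t * (of_real (sqrt (\<kappa> * k)) * poly (p (k - 1)) z)"
proof -
  have "poly (pderiv (p k)) z = of_real (sqrt (\<kappa> * k)) * poly (p (k - 1)) z"
    using DERIV_poly_p poly_DERIV by (rule DERIV_unique[symmetric])
  then have "poly (raising (p k)) z =
     of_real \<kappa> * z * poly (p k) z - of_real t * (of_real (sqrt (\<kappa> * k)) * poly (p (k - 1)) z)"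
    by (simp add: raising_def)
  then show ?thesis by (simp add: ladder(1))
qed

text \<open>The coefficients are real, since \<open>p 0\<close> and the recurrence are. This is what
  later turns a product of values at \<open>cnj w\<close> and w into a squared modulus.\<close>

lemma poly_p_cnj: "poly (p k) (cnj z) = cnj (poly (p k) z)"
proof (induction k rule: less_induct)
  case (less k)
  show ?case
  proof (cases k)
    case 0
    then show ?thesis by (simp add: p_0)
  next
    case (Suc j)
    have nz: "complex_of_real (sqrt (\<kappa> * Suc j)) \<noteq> 0" using \<kappa>_pos by simp
    have "of_real (sqrt (\<kappa> * j)) * poly (p (j - 1)) (cnj z) = cnj (of_real (sqrt (\<kappa> * j)) * poly (p (j - 1)) z)"
      using less Suc by (cases j) auto
    moreover have "poly (p j) (cnj z) = cnj (poly (p j) z)" using less Suc by simp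
    ultimately have "of_real (sqrt (\<kappa> * Suc j)) * poly (p (Suc j)) (cnj z) =
        cnj (of_real (sqrt (\<kappa> * Suc j)) * poly (p (Suc j)) z)"
      unfolding poly_p_recurrence by simp
    then show ?thesis using nz Suc by simp
  qed
qed

text \<open>After division by \<open>sqrt (\<kappa> * Suc k)\<close> the recurrence has a
  coefficient of order 1 / sqrt k at the current polynomial and one of at most t at the previous
  one. Hence every rate above sqrt t bounds the growth in k, uniformly on discs.\<close>

lemma poly_p_bound:
  assumes \<rho>: "\<rho> > 0" "\<rho>\<^sup>2 > t"
  obtains C where "C \<ge> 0" "\<And>k z. cmod z \<le> R \<Longrightarrow> cmod (poly (p k) z) \<le> C * \<rho> ^ k"
proof -
  \<comment> \<open>Chosen so that \<delta> \<rho>^j + t \<rho>^(j-1) = \<rho>^(j+1), which closes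
    the induction.\<close>
  define \<delta> where "\<delta> = (\<rho>\<^sup>2 - t) / \<rho>"
  have \<delta>: "\<delta> > 0" using \<rho> by (simp add: \<delta>_def)
  \<comment> \<open>For j >= N the first coefficient satisfies
    \<open>\<kappa> * R \<le> sqrt (\<kappa> * Suc j) * \<delta>\<close>; the finitely many smaller
    indices are absorbed into the constant C.\<close>
  define N where "N = nat \<lceil>\<kappa> * R\<^sup>2 / \<delta>\<^sup>2\<rceil>"
  have "\<exists>B\<ge>0. \<forall>z\<in>cball 0 R. cmod (poly (p k) z) \<le> B * \<rho> ^ k" for k
  proof -
    have "compact (poly (p k) ` cball 0 R)"
      by (intro compact_continuous_image continuous_intros) auto
    then obtain B where "B > 0" "\<forall>z\<in>cball 0 R. cmod (poly (p k) z) \<le> B"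
      using compact_imp_bounded bounded_pos by (metis imageI)
    then show ?thesis using \<rho> by (intro exI[of _ "B / \<rho> ^ k"]) auto
  qed
  then obtain B where B: "\<And>k. B k \<ge> 0" "\<And>k z. cmod z \<le> R \<Longrightarrow> cmod (poly (p k) z) \<le> B k * \<rho> ^ k"
    by (metis mem_cball_0)
  define C where "C = (\<Sum>k\<le>N. B k)"
  have C: "C \<ge> 0" by (simp add: C_def B sum_nonneg)
  have "cmod (poly (p k) z) \<le> C * \<rho> ^ k" if z: "cmod z \<le> R" for k z
  proof (induction k rule: less_induct)
    case (less k)
    show ?case
    proof (cases "k \<le> N")
      case True
      then have "B k \<le> C" unfolding C_def by (intro member_le_sum) (auto simp: B)
      then have "B k * \<rho> ^ k \<le> C * \<rho> ^ k" using \<rho> by (intro mult_right_mono) auto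
      then show ?thesis using B(2)[OF z] order.trans by blast
    next
      case False
      then obtain j where k: "k = Suc j" "N \<le> j" by (cases k) auto
      define s where "s = sqrt (\<kappa> * Suc j)"
      have s: "s > 0" using \<kappa>_pos by (simp add: s_def)
      have "\<kappa> * R\<^sup>2 / \<delta>\<^sup>2 \<le> j" using k(2) by (simp add: N_def)
      then have "\<kappa> * R\<^sup>2 \<le> Suc j * \<delta>\<^sup>2" using \<delta> by (simp add: field_simps add_increasing)
      then have "\<kappa> * (\<kappa> * R\<^sup>2) \<le> \<kappa> * (Suc j * \<delta>\<^sup>2)" using \<kappa>_pos by simp
      then have "(\<kappa> * R)\<^sup>2 \<le> (s * \<delta>)\<^sup>2"
        using \<kappa>_pos by (simp add: s_def power_mult_distrib power2_eq_square algebra_simps)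
      then have 1: "\<kappa> * R \<le> s * \<delta>" by (rule power2_le_imp_le) (use s \<delta> in simp)
      have IH1: "cmod (poly (p j) z) \<le> C * \<rho> ^ j" using less k by simp
      have IH2: "sqrt (\<kappa> * j) * cmod (poly (p (j - 1)) z) * \<rho> \<le> s * (C * \<rho> ^ j)"
      proof (cases j)
        case (Suc i)
        have "cmod (poly (p i) z) \<le> C * \<rho> ^ i" using less k Suc by simp
        then have e1: "cmod (poly (p i) z) * \<rho> \<le> C * \<rho> ^ j"
          using mult_right_mono[of "cmod (poly (p i) z)" "C * \<rho> ^ i" \<rho>] \<rho> Suc by (simp add: mult_ac)
        have e2: "sqrt (\<kappa> * j) \<le> s"
          unfolding s_def using \<kappa>_pos by (intro real_sqrt_le_mono mult_left_mono) auto
        have "sqrt (\<kappa> * j) * (cmod (poly (p i) z) * \<rho>) \<le> s * (C * \<rho> ^ j)"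
          by (rule mult_mono'[OF e2 e1]) (use \<kappa>_pos \<rho> in auto)
        then show ?thesis using Suc by (simp only: mult.assoc diff_Suc_1)
      qed (use s C in simp)
      have "s * cmod (poly (p k) z) = cmod (of_real s * poly (p k) z)"
        using s by (simp add: norm_mult)
      also have "of_real s * poly (p k) z = of_real \<kappa> * z * poly (p j) z - of_real t * (of_real (sqrt (\<kappa> * j)) * poly (p (j - 1)) z)"
        using poly_p_recurrence[of j z] by (simp add: s_def k)
      also have "cmod \<dots> \<le> cmod (of_real \<kappa> * z * poly (p j) z) + cmod (of_real t * (of_real (sqrt (\<kappa> * j)) * poly (p (j - 1)) z))"
        by (rule norm_triangle_ineq4)
      also have "\<dots> = \<kappa> * cmod z * cmod (poly (p j) z) + t * (sqrt (\<kappa> * j) * cmod (poly (p (j - 1)) z))"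
        using \<kappa>_pos t by (simp add: norm_mult)
      finally have "s * cmod (poly (p k) z) * \<rho> \<le> (\<kappa> * cmod z * cmod (poly (p j) z) + t * (sqrt (\<kappa> * j) * cmod (poly (p (j - 1)) z))) * \<rho>"
        by (rule mult_right_mono) (use \<rho> in simp)
      also have "\<dots> = (\<kappa> * cmod z * cmod (poly (p j) z)) * \<rho> + t * (sqrt (\<kappa> * j) * cmod (poly (p (j - 1)) z) * \<rho>)"
        by (simp add: algebra_simps)
      also have "\<dots> \<le> (s * \<delta> * (C * \<rho> ^ j)) * \<rho> + t * (s * (C * \<rho> ^ j))"
      proof (rule add_mono)
        have "\<kappa> * cmod z \<le> \<kappa> * R" using z \<kappa>_pos by simp
        then have "\<kappa> * cmod z \<le> s * \<delta>" using 1 by linarith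
        then have "\<kappa> * cmod z * cmod (poly (p j) z) \<le> s * \<delta> * (C * \<rho> ^ j)"
          using IH1 by (rule mult_mono) (use s \<delta> in auto)
        then show "\<kappa> * cmod z * cmod (poly (p j) z) * \<rho> \<le> s * \<delta> * (C * \<rho> ^ j) * \<rho>"
          by (rule mult_right_mono) (use \<rho> in simp)
        show "t * (sqrt (\<kappa> * j) * cmod (poly (p (j - 1)) z) * \<rho>) \<le> t * (s * (C * \<rho> ^ j))"
          by (rule mult_left_mono[OF IH2]) (use t in simp)
      qed
      also have "\<dots> = s * (C * \<rho> ^ k) * \<rho>"
        using \<rho> by (simp add: \<delta>_def k field_simps power2_eq_square)
      finally show ?thesis using s \<rho> by simp
    qed
  qed
  with C that show ?thesis by blast
qed

section \<open>The generating function of products of orthonormal polynomials\<close>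

definition mehler_sum :: "complex \<Rightarrow> complex \<Rightarrow> complex \<Rightarrow> complex" where
  "mehler_sum s u v = (\<Sum>k. s ^ k * poly (p k) u * poly (p k) v)"

text \<open>Take r between t and 1 / |s| (any r > t if s = 0) and the growth rate sqrt r: the two
  polynomial factors together contribute r^k, and |s| r < 1 leaves a geometric majorant.\<close>

lemma mehler_sum_dominated:
  assumes s: "cmod s * t < 1"
  obtains M where "summable M"
    "\<And>k u v. cmod u \<le> R \<Longrightarrow> cmod v \<le> R \<Longrightarrow> cmod (s ^ k * poly (p k) u * poly (p k) v) \<le> M k"
proof -
  obtain r where r: "r > t" "cmod s * r < 1"
  proof (cases "s = 0")
    case True
    then show ?thesis using that[of "t + 1"] by simp
  next
    case False
    then have "t < 1 / cmod s" using s by (simp add: field_simps)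
    then obtain r where "t < r" "r < 1 / cmod s" using dense by blast
    then show ?thesis using that[of r] False by (simp add: field_simps)
  qed
  define \<rho> where "\<rho> = sqrt r"
  have \<rho>: "\<rho> > 0" "\<rho>\<^sup>2 = r" using r t by (auto simp: \<rho>_def)
  obtain C where C: "C \<ge> 0" "\<And>k z. cmod z \<le> R \<Longrightarrow> cmod (poly (p k) z) \<le> C * \<rho> ^ k"
    using poly_p_bound[of \<rho> R] \<rho> r by auto
  show ?thesis
  proof
    show "summable (\<lambda>k. C\<^sup>2 * (cmod s * r) ^ k)"
      using r t by (intro summable_mult summable_geometric) auto
    fix k u v assume uv: "cmod u \<le> R" "cmod v \<le> R"
    have "cmod (s ^ k * poly (p k) u * poly (p k) v) = cmod s ^ k * cmod (poly (p k) u) * cmod (poly (p k) v)"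
      by (simp add: norm_mult norm_power)
    also have "\<dots> \<le> cmod s ^ k * (C * \<rho> ^ k) * (C * \<rho> ^ k)"
      using C \<rho> uv by (intro mult_mono) auto
    also have "\<dots> = C\<^sup>2 * (cmod s * r) ^ k"
      unfolding \<rho>(2)[symmetric] by (simp add: power_mult_distrib power2_eq_square mult_ac)
    finally show "cmod (s ^ k * poly (p k) u * poly (p k) v) \<le> C\<^sup>2 * (cmod s * r) ^ k" .
  qed
qed

lemma summable_mehler:
  assumes "cmod s * t < 1"
  shows "summable (\<lambda>k. s ^ k * poly (p k) u * poly (p k) v)"
proof -
  obtain M where M: "summable M" "\<And>k u' v'. cmod u' \<le> max (cmod u) (cmod v) \<Longrightarrow> cmod v' \<le> max (cmod u) (cmod v) \<Longrightarrow>
     cmod (s ^ k * poly (p k) u' * poly (p k) v') \<le> M k"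
    using mehler_sum_dominated[OF assms] by blast
  show ?thesis
    by (rule summable_comparison_test'[OF M(1), of 0], rule M(2)) simp_all
qed

lemma mehler_sum_commute: "mehler_sum s u v = mehler_sum s v u"
  by (simp add: mehler_sum_def mult_ac)

text \<open>Locally uniform convergence on unit discs justifies termwise differentiation. The
  derivative is kept as a series because the recurrence will act on its terms.\<close>

lemma mehler_sum_derivative:
  assumes s: "cmod s * t < 1"
  obtains D where
    "\<And>u v. ((\<lambda>u. mehler_sum s u v) has_field_derivative D u v) (at u)"
    "\<And>u v. (\<lambda>k. s ^ k * (of_real (sqrt (\<kappa> * k)) * poly (p (k - 1)) u) * poly (p k) v) sums D u v"
proof -
  define Q where "Q = (\<lambda>v D. \<forall>u\<in>UNIV. ((\<lambda>u. mehler_sum s u v) has_field_derivative D u) (at u) \<and>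
     (\<lambda>N. \<Sum>k<N. s ^ k * (of_real (sqrt (\<kappa> * k)) * poly (p (k - 1)) u) * poly (p k) v) \<longlonglongrightarrow> D u)"
  have "\<exists>D. Q v D" for v
    unfolding Q_def
  proof (rule has_complex_derivative_uniform_sequence)
    show "((\<lambda>u. \<Sum>k<N. s ^ k * poly (p k) u * poly (p k) v) has_field_derivative
       (\<Sum>k<N. s ^ k * (of_real (sqrt (\<kappa> * k)) * poly (p (k - 1)) u) * poly (p k) v)) (at u)" for N u
      by (rule DERIV_sum, rule DERIV_cmult_right, rule DERIV_cmult, rule DERIV_poly_p)
    fix u :: complex
    obtain M where M: "summable M" "\<And>k u' v'. cmod u' \<le> max (cmod u + 1) (cmod v) \<Longrightarrow> cmod v' \<le> max (cmod u + 1) (cmod v) \<Longrightarrow>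
       cmod (s ^ k * poly (p k) u' * poly (p k) v') \<le> M k"
      using mehler_sum_dominated[OF s] by blast
    have "uniform_limit (cball u 1) (\<lambda>N u. \<Sum>k<N. s ^ k * poly (p k) u * poly (p k) v) (\<lambda>u. mehler_sum s u v) sequentially"
      unfolding mehler_sum_def
    proof (rule Weierstrass_m_test[OF _ M(1)])
      fix k u' assume "u' \<in> cball u 1"
      then have "cmod u' \<le> cmod u + 1"
        by (metis add.commute add_left_mono dist_commute dist_norm mem_cball norm_triangle_sub order_trans)
      then show "cmod (s ^ k * poly (p k) u' * poly (p k) v) \<le> M k" by (intro M(2)) auto
    qed
    then show "\<exists>d>0. cball u d \<subseteq> UNIV \<and> uniform_limit (cball u d) (\<lambda>N u. \<Sum>k<N. s ^ k * poly (p k) u * poly (p k) v) (\<lambda>u. mehler_sum s u v) sequentially"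
      by (intro exI[of _ 1]) auto
  qed auto
  then obtain D where "\<And>v. Q v (D v)" by metis
  then show ?thesis using that[of "\<lambda>u v. D v u"] by (simp add: Q_def sums_def)
qed

lemma one_minus_st_nonzero:
  assumes "cmod s * t < 1"
  shows "1 - (s * of_real t)\<^sup>2 \<noteq> 0"
proof
  assume "1 - (s * of_real t)\<^sup>2 = 0"
  then have "cmod ((s * of_real t)\<^sup>2) = 1" by simp
  then have "(cmod s * t)\<^sup>2 = 1" using t by (simp add: norm_power norm_mult)
  moreover have "(cmod s * t)\<^sup>2 < 1" using assms t by (simp add: power_less_one_iff)
  ultimately show False by simp
qed

text \<open>Shifting the index in the u-derivative and applying the recurrence to
  \<open>p (Suc k)\<close> at v produces the v-derivative. By symmetry the same relation holds with
  u and v exchanged; solving the resulting pair of linear equations for \<open>D u v\<close> leaves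
  a first-order linear differential equation in u.\<close>

lemma mehler_sum_DERIV:
  assumes s: "cmod s * t < 1"
  shows "((\<lambda>u. mehler_sum s u v) has_field_derivative
           of_real \<kappa> * (s * v - s\<^sup>2 * of_real t * u) / (1 - (s * of_real t)\<^sup>2) * mehler_sum s u v) (at u)"
proof -
  obtain D where D: "\<And>u v. ((\<lambda>u. mehler_sum s u v) has_field_derivative D u v) (at u)"
    "\<And>u v. (\<lambda>k. s ^ k * (of_real (sqrt (\<kappa> * k)) * poly (p (k - 1)) u) * poly (p k) v) sums D u v"
    using mehler_sum_derivative[OF s] by blast
  have eq: "D u v = s * of_real \<kappa> * v * mehler_sum s u v - s * of_real t * D v u" for u v
  proof -
    define f where "f = (\<lambda>k. s ^ k * (of_real (sqrt (\<kappa> * k)) * poly (p (k - 1)) u) * poly (p k) v)"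
    have "(\<lambda>k. f (Suc k)) sums D u v"
      by (subst sums_Suc_iff) (use D(2)[of u v] in \<open>simp add: f_def\<close>)
    then have "(\<lambda>k. s ^ Suc k * (of_real (sqrt (\<kappa> * Suc k)) * poly (p k) u) * poly (p (Suc k)) v) sums D u v"
      unfolding f_def diff_Suc_1 .
    moreover have "(\<lambda>k. s * of_real \<kappa> * v * (s ^ k * poly (p k) u * poly (p k) v) -
          s * of_real t * (s ^ k * (of_real (sqrt (\<kappa> * k)) * poly (p (k - 1)) v) * poly (p k) u))
        sums (s * of_real \<kappa> * v * mehler_sum s u v - s * of_real t * D v u)"
      unfolding mehler_sum_def by (intro sums_diff sums_mult D(2) summable_sums summable_mehler s)
    moreover have "s ^ Suc k * (of_real (sqrt (\<kappa> * Suc k)) * poly (p k) u) * poly (p (Suc k)) v =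
       s * of_real \<kappa> * v * (s ^ k * poly (p k) u * poly (p k) v) -
          s * of_real t * (s ^ k * (of_real (sqrt (\<kappa> * k)) * poly (p (k - 1)) v) * poly (p k) u)" for k
    proof -
      have "s ^ Suc k * (of_real (sqrt (\<kappa> * Suc k)) * poly (p k) u) * poly (p (Suc k)) v
         = s ^ Suc k * poly (p k) u * (of_real (sqrt (\<kappa> * Suc k)) * poly (p (Suc k)) v)"
        by (simp only: mult_ac)
      then show ?thesis unfolding poly_p_recurrence by (simp add: algebra_simps)
    qed
    ultimately show ?thesis by (simp only: sums_unique2)
  qed
  have "D u v = s * of_real \<kappa> * v * mehler_sum s u v - s * of_real t * (s * of_real \<kappa> * u * mehler_sum s u v - s * of_real t * D u v)"
    using eq[of u v] eq[of v u] mehler_sum_commute[of s v u] by simp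
  then have "D u v * (1 - (s * of_real t)\<^sup>2) = of_real \<kappa> * (s * v - s\<^sup>2 * of_real t * u) * mehler_sum s u v"
    by (simp add: algebra_simps power2_eq_square)
  then have "D u v = of_real \<kappa> * (s * v - s\<^sup>2 * of_real t * u) / (1 - (s * of_real t)\<^sup>2) * mehler_sum s u v"
    using one_minus_st_nonzero[OF s] by (simp add: field_simps)
  then show ?thesis using D(1)[of v u] by simp
qed

text \<open>The antiderivative in u of the coefficient in that differential equation, normalized to
  be symmetric in u and v.\<close>

definition mehler_exponent :: "complex \<Rightarrow> complex \<Rightarrow> complex \<Rightarrow> complex" where
  "mehler_exponent s u v =
     of_real \<kappa> * (s * u * v - s\<^sup>2 * of_real t * (u\<^sup>2 + v\<^sup>2) / 2) / (1 - (s * of_real t)\<^sup>2)"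

lemma mehler_sum_eq_aux:
  assumes s: "cmod s * t < 1"
  shows "mehler_sum s u v = mehler_sum s 0 v * exp (mehler_exponent s u v - mehler_exponent s 0 v)"
proof -
  have nz: "1 - (s * of_real t)\<^sup>2 \<noteq> 0" by (rule one_minus_st_nonzero[OF s])
  define f where "f = (\<lambda>u. mehler_sum s u v * exp (- mehler_exponent s u v))"
  have "(f has_field_derivative 0) (at u)" for u
  proof -
    have E: "((\<lambda>u. mehler_exponent s u v) has_field_derivative
           of_real \<kappa> * (s * v - s\<^sup>2 * of_real t * u) / (1 - (s * of_real t)\<^sup>2)) (at u)"
      unfolding mehler_exponent_def
      by (rule DERIV_cdivide) (auto intro!: derivative_eq_intros simp: algebra_simps power2_eq_square)
    show ?thesis
      unfolding f_def
      by (rule DERIV_cong[OF DERIV_mult[OF mehler_sum_DERIV[OF s] DERIV_fun_exp[OF DERIV_minus[OF E]]]])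
         (simp add: algebra_simps)
  qed
  then have "f u = f 0"
    using has_field_derivative_zero_constant[of UNIV f] by auto
  then have "f u * exp (mehler_exponent s u v) = f 0 * exp (mehler_exponent s u v)" by simp
  then show ?thesis
    by (simp add: f_def mult.assoc exp_add[symmetric] flip: exp_diff)
qed

text \<open>Polynomials of odd index vanish at 0. For the even ones the recurrence gives consecutive
  terms the ratio (s t)^2 (2j + 1) / (2j + 2), which is that of the binomial series with exponent
  -1/2.\<close>

lemma mehler_sum_0:
  assumes s: "cmod s * t < 1"
  shows "mehler_sum s 0 0 = of_real (real n * sqrt (1 - t\<^sup>2) / pi) * (1 - (s * of_real t)\<^sup>2) powr (- 1 / 2)"
proof -
  define a where "a = (\<lambda>k. s ^ k * poly (p k) 0 * poly (p k) 0)"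
  define c where "c = complex_of_real (real n * sqrt (1 - t\<^sup>2) / pi)"
  have rec: "of_real (sqrt (real (k + 2))) * poly (p (k + 2)) 0 = - of_real t * (of_real (sqrt (real (k + 1))) * poly (p k) 0)" for k
  proof -
    have "of_real (sqrt \<kappa>) * (of_real (sqrt (real (k + 2))) * poly (p (k + 2)) 0) = of_real (sqrt \<kappa>) * (- of_real t * (of_real (sqrt (real (k + 1))) * poly (p k) 0))"
      using poly_p_recurrence[of "Suc k" 0] by (simp add: real_sqrt_mult mult_ac)
    moreover have "complex_of_real (sqrt \<kappa>) \<noteq> 0" using \<kappa>_pos by simp
    ultimately show ?thesis by (metis mult_left_cancel)
  qed
  have odd: "poly (p (2 * j + 1)) 0 = 0" for j
  proof (induction j)
    case 0
    then show ?case using poly_p_recurrence[of 0 0] \<kappa>_pos by simp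
  next
    case (Suc j)
    have "complex_of_real (sqrt (real ((2 * j + 1) + 2))) \<noteq> 0"
      by (simp only: of_real_eq_0_iff real_sqrt_eq_zero_cancel_iff of_nat_eq_0_iff)
    then show ?case using rec[of "2 * j + 1"] Suc by simp
  qed
  have even: "a (2 * j) = c * (((- 1 / 2) gchoose j) * (- (s * of_real t)\<^sup>2) ^ j)" for j
  proof (induction j)
    case 0
    define x where "x = real n * sqrt (1 - t\<^sup>2) / pi"
    have "x \<ge> 0" using t by (simp add: x_def power_le_one)
    then have "complex_of_real (sqrt x) * complex_of_real (sqrt x) = of_real x"
      unfolding of_real_mult[symmetric] by simp
    moreover have "p 0 = [:of_real (sqrt x):]" "c = of_real x" by (simp_all only: p_0 c_def x_def)
    ultimately show ?case by (simp add: a_def)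
  next
    case (Suc j)
    define k where "k = 2 * j"
    have sq: "complex_of_real (sqrt (real m)) * complex_of_real (sqrt (real m)) = of_nat m" for m
      by (metis of_nat_0_le_iff of_real_mult of_real_of_nat_eq real_sqrt_mult_self abs_of_nonneg)
    have "of_nat (k + 2) * a (k + 2) = s ^ (k + 2) * (of_real (sqrt (real (k + 2))) * poly (p (k + 2)) 0) * (of_real (sqrt (real (k + 2))) * poly (p (k + 2)) 0)"
      unfolding a_def sq[symmetric] by (simp only: mult_ac)
    also have "\<dots> = (s * of_real t)\<^sup>2 * (of_nat (k + 1) * a k)"
      unfolding rec a_def sq[symmetric] by (simp add: power2_eq_square mult_ac)
    finally have 1: "of_nat (k + 2) * a (k + 2) = (s * of_real t)\<^sup>2 * (of_nat (k + 1) * a k)" .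
    have 2: "of_nat (Suc j) * ((- 1 / 2 :: complex) gchoose Suc j) = (- 1 / 2 - of_nat j) * ((- 1 / 2) gchoose j)"
      using gbinomial_absorb_comp[of "- 1 / 2 :: complex" j] gbinomial_mult_1[of "- 1 / 2 :: complex" j]
      by (simp add: algebra_simps)
    have "of_nat (k + 2) * a (k + 2) = (s * of_real t)\<^sup>2 * (of_nat (k + 1) * (c * (((- 1 / 2) gchoose j) * (- (s * of_real t)\<^sup>2) ^ j)))"
      unfolding 1 using Suc by (simp add: k_def)
    also have "\<dots> = 2 * c * ((- 1 / 2 - of_nat j) * ((- 1 / 2) gchoose j)) * (- (s * of_real t)\<^sup>2) ^ Suc j"
      by (simp add: k_def algebra_simps)
    also have "\<dots> = of_nat (k + 2) * (c * (((- 1 / 2) gchoose Suc j) * (- (s * of_real t)\<^sup>2) ^ Suc j))"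
      unfolding 2[symmetric] by (simp add: k_def algebra_simps)
    finally have "a (k + 2) = c * (((- 1 / 2) gchoose Suc j) * (- (s * of_real t)\<^sup>2) ^ Suc j)"
      by (simp only: mult_cancel_left of_nat_eq_0_iff) simp
    then show ?case by (simp add: k_def)
  qed
  have "cmod (- (s * of_real t)\<^sup>2) < 1"
    using s t by (simp add: norm_power norm_mult power_less_one_iff)
  from gen_binomial_complex[OF this, of "- 1 / 2"]
  have "(\<lambda>j. a (2 * j)) sums (c * (1 + - (s * of_real t)\<^sup>2) powr (- 1 / 2))"
    unfolding even by (rule sums_mult)
  then have "a sums (c * (1 + - (s * of_real t)\<^sup>2) powr (- 1 / 2))"
  proof (subst (asm) sums_mono_reindex)
    show "strict_mono (\<lambda>j::nat. 2 * j)" by (simp add: strict_mono_def)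
    fix k assume "k \<notin> range (\<lambda>j::nat. 2 * j)"
    then have "odd k" by (metis evenE rangeI)
    then obtain j where "k = 2 * j + 1" by (rule oddE)
    then show "a k = 0" using odd[of j] by (simp add: a_def)
  qed
  then show ?thesis
    unfolding mehler_sum_def by (simp add: a_def c_def sums_iff)
qed

lemma mehler:
  assumes s: "cmod s * t < 1"
  shows "(\<lambda>k. s ^ k * poly (p k) u * poly (p k) v) sums
     (of_real (real n * sqrt (1 - t\<^sup>2) / pi) * (1 - (s * of_real t)\<^sup>2) powr (- 1 / 2) * exp (mehler_exponent s u v))"
proof -
  \<comment> \<open>The differential equation moves one argument to 0; exchanging the arguments lets
    it move the other.\<close>
  have "mehler_sum s u v = mehler_sum s v 0 * exp (mehler_exponent s u v - mehler_exponent s 0 v)"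
    by (subst mehler_sum_eq_aux[OF s], subst mehler_sum_commute) simp
  also have "mehler_sum s v 0 = mehler_sum s 0 0 * exp (mehler_exponent s v 0 - mehler_exponent s 0 0)"
    by (rule mehler_sum_eq_aux[OF s])
  also have "\<dots> = mehler_sum s 0 0 * exp (mehler_exponent s 0 v)"
    by (simp add: mehler_exponent_def)
  finally have "mehler_sum s u v = mehler_sum s 0 0 * exp (mehler_exponent s u v)"
    by (simp add: mult.assoc exp_add[symmetric])
  then show ?thesis
    using summable_sums[OF summable_mehler[OF s], of u v]
    unfolding mehler_sum_def[symmetric] mehler_sum_0[OF s] by (simp only:)
qed

end

section \<open>The index distribution\<close>

text \<open>Mehler's formula on the diagonal makes \<open>n * growth t s w\<close> the logarithm of the generating function
  of the index distribution, up to a factor independent of \<open>w\<close>.\<close>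

definition growth :: "real \<Rightarrow> 'a::real_normed_field \<Rightarrow> complex \<Rightarrow> 'a" where
  "growth t s w = of_real (1 - t\<^sup>2) *
     (of_real ((Re w)\<^sup>2) * (s / (1 + of_real t * s) - 1 / (1 + of_real t)) +
      of_real ((Im w)\<^sup>2) * (s / (1 - of_real t * s) - 1 / (1 - of_real t)))"

definition index_density :: "real \<Rightarrow> nat \<Rightarrow> (nat \<Rightarrow> complex poly) \<Rightarrow> complex \<Rightarrow> nat \<Rightarrow> real" where
  "index_density t n p w k =
     pi / real n * exp (- real n * elliptic_potential t w) * (cmod (poly (p k) w))\<^sup>2"

lemma index_density_nonneg: "index_density t n p w k \<ge> 0"
  by (simp add: index_density_def)

lemma growth_of_real: "growth t (of_real r) w = of_real (growth t r w)"
  by (simp add: growth_def)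

lemma pgf_normalization:
  assumes "0 < t" "t < 1"
  shows "complex_of_real (sqrt (1 - t\<^sup>2)) * (1 - (1 * of_real t)\<^sup>2) powr (- 1 / 2) = 1"
proof -
  have pos: "1 - t\<^sup>2 > 0" using assms by (simp add: power_less_one_iff)
  have "(1 - (1 * of_real t)\<^sup>2 :: complex) powr (- 1 / 2) = of_real ((1 - t\<^sup>2) powr (- 1 / 2))"
    using pos powr_of_real[of "1 - t\<^sup>2" "- 1 / 2"] by simp
  also have "(1 - t\<^sup>2) powr (- 1 / 2) = 1 / sqrt (1 - t\<^sup>2)"
    using pos by (simp add: powr_minus_divide powr_half_sqrt)
  finally show ?thesis using pos by simp
qed

context elliptic_orthonormal
begin

text \<open>For w = x + \<i> y the product of the arguments is x^2 + y^2 and the sum of their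
  squares is 2 (x^2 - y^2). The denominator factors as (1 + t s)(1 - t s), and each coordinate
  cancels one factor. The potential is the value of the same expression at s = 1, divided by n; this
  is the origin of the subtracted constants in \<open>growth\<close>.\<close>

lemma mehler_exponent_diagonal:
  assumes s: "cmod s * t < 1"
  shows "mehler_exponent s (cnj w) w - of_nat n * of_real (elliptic_potential t w) = of_nat n * growth t s w"
proof -
  define T X Y where "T = complex_of_real t" "X = complex_of_real (Re w)" "Y = complex_of_real (Im w)"
  have w: "w = X + \<i> * Y" "cnj w = X - \<i> * Y" by (auto simp: T_X_Y_def complex_eq_iff)
  have "(1 + T * s) * (1 - T * s) \<noteq> 0"
    using one_minus_st_nonzero[OF s] by (simp add: T_X_Y_def power2_eq_square algebra_simps)
  then have nz: "1 + T * s \<noteq> 0" "1 - T * s \<noteq> 0" by auto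
  have nzt: "1 + T \<noteq> 0" "1 - T \<noteq> 0"
    using t by (simp_all add: T_X_Y_def complex_eq_iff)
  have d: "1 - (s * T)\<^sup>2 = (1 + T * s) * (1 - T * s)" by (simp add: power2_eq_square algebra_simps)
  have "s * u * v - s\<^sup>2 * T * (u\<^sup>2 + v\<^sup>2) / 2 = X\<^sup>2 * s * (1 - T * s) + Y\<^sup>2 * s * (1 + T * s)"
    if "u = X - \<i> * Y" "v = X + \<i> * Y" for u v
    unfolding that by (simp add: power2_eq_square field_simps)
  from this[OF w(2,1)] have "mehler_exponent s (cnj w) w = of_nat n * (1 - T\<^sup>2) * ((X\<^sup>2 * s * (1 - T * s) + Y\<^sup>2 * s * (1 + T * s)) / ((1 + T * s) * (1 - T * s)))"
    by (simp add: mehler_exponent_def \<kappa>_def d[symmetric] flip: T_X_Y_def)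
  also have "(X\<^sup>2 * s * (1 - T * s) + Y\<^sup>2 * s * (1 + T * s)) / ((1 + T * s) * (1 - T * s)) =
      X\<^sup>2 * (s / (1 + T * s)) + Y\<^sup>2 * (s / (1 - T * s))"
    using nz by (simp add: divide_simps)
  finally have 1: "mehler_exponent s (cnj w) w = of_nat n * ((1 - T\<^sup>2) * (X\<^sup>2 * (s / (1 + T * s)) + Y\<^sup>2 * (s / (1 - T * s))))"
    by simp
  have "complex_of_real (elliptic_potential t w) = (1 - T) * X\<^sup>2 + (1 + T) * Y\<^sup>2"
    by (simp add: elliptic_potential_eq T_X_Y_def)
  also have "\<dots> = (1 - T\<^sup>2) * (X\<^sup>2 * (1 / (1 + T)) + Y\<^sup>2 * (1 / (1 - T)))"
    using nzt by (simp add: divide_simps) (simp add: algebra_simps power2_eq_square)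
  finally have 2: "complex_of_real (elliptic_potential t w) = (1 - T\<^sup>2) * (X\<^sup>2 * (1 / (1 + T)) + Y\<^sup>2 * (1 / (1 - T)))" .
  show ?thesis
    unfolding 1 2 growth_def
    by (simp add: algebra_simps flip: T_X_Y_def)
qed

lemma index_density_pgf:
  assumes s: "cmod s * t < 1"
  shows "(\<lambda>k. of_real (index_density t n p w k) * s ^ k) sums
     (of_real (sqrt (1 - t\<^sup>2)) * (1 - (s * of_real t)\<^sup>2) powr (- 1 / 2) * exp (of_nat n * growth t s w))"
proof -
  define C where "C = complex_of_real (pi / real n * exp (- real n * elliptic_potential t w))"
  have "(\<lambda>k. C * (s ^ k * poly (p k) (cnj w) * poly (p k) w)) sums
     (C * (of_real (real n * sqrt (1 - t\<^sup>2) / pi) * (1 - (s * of_real t)\<^sup>2) powr (- 1 / 2) * exp (mehler_exponent s (cnj w) w)))"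
    by (intro sums_mult mehler s)
  moreover have "C * (s ^ k * poly (p k) (cnj w) * poly (p k) w) = of_real (index_density t n p w k) * s ^ k" for k
  proof -
    have "poly (p k) (cnj w) * poly (p k) w = of_real ((cmod (poly (p k) w))\<^sup>2)"
      using complex_norm_square[of "poly (p k) w"] by (simp add: poly_p_cnj mult.commute)
    then show ?thesis by (simp add: C_def index_density_def mult_ac)
  qed
  moreover have "C * (of_real (real n * sqrt (1 - t\<^sup>2) / pi) * (1 - (s * of_real t)\<^sup>2) powr (- 1 / 2) * exp (mehler_exponent s (cnj w) w))
    = of_real (sqrt (1 - t\<^sup>2)) * (1 - (s * of_real t)\<^sup>2) powr (- 1 / 2) * exp (of_nat n * growth t s w)"
    unfolding mehler_exponent_diagonal[OF s, symmetric] exp_diff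
    using n by (simp add: C_def exp_minus exp_of_real[symmetric] field_simps)
  ultimately show ?thesis by simp
qed

lemma index_density_sums: "index_density t n p w sums 1"
proof -
  note pgf_normalization[OF t]
  moreover have "growth t 1 w = (0 :: complex)" by (simp add: growth_def)
  ultimately have "(\<lambda>k. complex_of_real (index_density t n p w k)) sums of_real 1"
    using index_density_pgf[of 1 w] t by simp
  then show ?thesis by (simp only: sums_of_real_iff)
qed

lemma sum_index_density_le_1: "(\<Sum>k<m. index_density t n p w k) \<le> 1"
  using sum_le_suminf[OF sums_summable[OF index_density_sums], of "{..<m}" w]
    sums_unique[OF index_density_sums] by (simp add: index_density_nonneg)

text \<open>For k >= n the weight r^(k-n) is at least 1, so the tail is at most the generating
  function at r divided by r^n. The \<open>cmod\<close> only converts the complex power into a real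
  prefactor.\<close>

lemma index_density_chernoff:
  assumes r: "r > 1" "r * t < 1"
  shows "1 - (\<Sum>k<n. index_density t n p w k) \<le>
    cmod (of_real (sqrt (1 - t\<^sup>2)) * (1 - (of_real r * of_real t)\<^sup>2) powr (- 1 / 2)) * exp (real n * (growth t r w - ln r))"
proof -
  define P where "P = cmod (of_real (sqrt (1 - t\<^sup>2)) * (1 - (of_real r * of_real t)\<^sup>2) powr (- 1 / 2)) * exp (real n * growth t r w)"
  define S where "S = (\<Sum>k. index_density t n p w k * r ^ k)"
  have s: "(\<lambda>k. complex_of_real (index_density t n p w k * r ^ k)) sums
     (of_real (sqrt (1 - t\<^sup>2)) * (1 - (of_real r * of_real t)\<^sup>2) powr (- 1 / 2) * exp (of_nat n * growth t (of_real r) w))"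
    using index_density_pgf[of "of_real r" w] r by simp
  then have sm: "summable (\<lambda>k. index_density t n p w k * r ^ k)"
    using sums_summable summable_complex_of_real by blast
  have "complex_of_real S = of_real (sqrt (1 - t\<^sup>2)) * (1 - (of_real r * of_real t)\<^sup>2) powr (- 1 / 2) * exp (of_nat n * growth t (of_real r) w)"
    using sums_unique2[OF sums_of_real[OF summable_sums[OF sm]] s] by (simp add: S_def)
  then have "cmod (of_real S) = P"
    by (simp add: P_def growth_of_real norm_mult)
  moreover have "S \<ge> 0" using r by (auto simp: S_def intro!: suminf_nonneg sm mult_nonneg_nonneg index_density_nonneg)
  ultimately have S: "S = P" by simp
  have "1 \<le> (\<Sum>k<n. index_density t n p w k) + S / r ^ n"
  proof (rule sums_le)
    show "index_density t n p w sums 1" by (rule index_density_sums)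
    show "(\<lambda>k. (if k \<in> {..<n} then index_density t n p w k else 0) + index_density t n p w k * r ^ k / r ^ n) sums
      ((\<Sum>k<n. index_density t n p w k) + S / r ^ n)"
      unfolding S_def by (intro sums_add sums_divide summable_sums sm sums_If_finite_set) auto
    fix k
    show "index_density t n p w k \<le> (if k \<in> {..<n} then index_density t n p w k else 0) + index_density t n p w k * r ^ k / r ^ n"
    proof (cases "k < n")
      case True
      then show ?thesis using r by (simp add: index_density_nonneg)
    next
      case False
      then have "r ^ n \<le> r ^ k" using r by (intro power_increasing) auto
      then have "1 \<le> r ^ k / r ^ n" using r by simp
      then show ?thesis using False mult_left_mono[OF _ index_density_nonneg, of 1 "r ^ k / r ^ n" t n p w k] by simp
    qed
  qed
  moreover have "exp (real n * (growth t r w - ln r)) = exp (real n * growth t r w) / r ^ n"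
    using r by (simp add: right_diff_distrib exp_diff exp_of_nat_mult)
  ultimately show ?thesis by (simp add: S P_def)
qed

end

section \<open>Concentration of the index inside the ellipse\<close>

lemma growth_derivative:
  assumes "0 < t" "t < 1"
  shows "((\<lambda>r. growth t r w) has_real_derivative
     (1 - t\<^sup>2) * ((Re w)\<^sup>2 / (1 + t)\<^sup>2 + (Im w)\<^sup>2 / (1 - t)\<^sup>2)) (at 1)"
  unfolding growth_def using assms
  by (auto intro!: derivative_eq_intros simp: power2_eq_square)

text \<open>Identifies the form that defines the ellipse with the derivative of
  \<open>growth\<close> at 1. Inside the ellipse that derivative is therefore smaller than 1, the
  slope of \<open>ln\<close> at 1.\<close>

lemma ellipse_form:
  assumes "0 < t" "t < 1"
  shows "(Re z)\<^sup>2 / (semiaxis_a t)\<^sup>2 + (Im z)\<^sup>2 / (semiaxis_b t)\<^sup>2 =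
    (1 - t\<^sup>2) * ((Re z)\<^sup>2 / (1 + t)\<^sup>2 + (Im z)\<^sup>2 / (1 - t)\<^sup>2)"
proof -
  have e: "1 - t\<^sup>2 = (1 + t) * (1 - t)" by (simp add: power2_eq_square algebra_simps)
  have sq: "(semiaxis_a t)\<^sup>2 = (1 + t) / (1 - t)" "(semiaxis_b t)\<^sup>2 = (1 - t) / (1 + t)"
    using assms by (simp_all add: semiaxis_a_def semiaxis_b_def)
  have "x / ((1 + t) / (1 - t)) = (1 + t) * (1 - t) * (x / (1 + t)\<^sup>2)"
    "x / ((1 - t) / (1 + t)) = (1 + t) * (1 - t) * (x / (1 - t)\<^sup>2)" for x :: real
    using assms by (simp_all add: power2_eq_square)
  then show ?thesis unfolding sq e by (simp only: distrib_left)
qed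

text \<open>The Chernoff exponent \<open>growth t r z0 - ln r\<close> vanishes at r = 1 with
  negative derivative, so it is negative for some r > 1. Continuity carries a negative bound over to
  the moving points \<open>w n\<close>, and the tail decays exponentially.\<close>

lemma tendsto_interior:
  assumes t: "0 < t" "t < 1" and orth: "\<And>n. n \<ge> 1 \<Longrightarrow> elliptic_orthonormal t n (p n)"
    and z0: "z0 \<in> ellipse_inside t" and w: "w \<longlonglongrightarrow> z0"
  shows "(\<lambda>n. \<Sum>k<n. index_density t n (p n) (w n) k) \<longlonglongrightarrow> 1"
proof -
  have neg: "(1 - t\<^sup>2) * ((Re z0)\<^sup>2 / (1 + t)\<^sup>2 + (Im z0)\<^sup>2 / (1 - t)\<^sup>2) - 1 < 0"
    using z0 ellipse_form[OF t, of z0] by (simp add: ellipse_inside_def)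
  have "((\<lambda>r. growth t r z0 - ln r) has_real_derivative
     (1 - t\<^sup>2) * ((Re z0)\<^sup>2 / (1 + t)\<^sup>2 + (Im z0)\<^sup>2 / (1 - t)\<^sup>2) - 1) (at 1)"
    using DERIV_diff[OF growth_derivative[OF t, of z0] DERIV_ln[of 1]] by simp
  from DERIV_neg_dec_right[OF this neg] obtain d :: real where d: "d > 0"
    "\<forall>h>0. h < d \<longrightarrow> growth t (1 + h) z0 - ln (1 + h) < growth t 1 z0 - ln 1" by (elim exE conjE)
  have "1 < 1 / t" using t by simp
  \<comment> \<open>The bound \<open>1 / t - 1\<close> keeps r = 1 + h inside the region of
    convergence, r t < 1.\<close>
  then obtain h where h: "0 < h" "h < d" "h < 1 / t - 1"
    using d(1) dense[of 0 "min d (1 / t - 1)"] by auto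
  define r where "r = 1 + h"
  have r: "r > 1" "r * t < 1" using h t by (auto simp: r_def field_simps)
  define \<delta> where "\<delta> = - (growth t r z0 - ln r) / 2"
  have \<delta>: "\<delta> > 0" using d(2) h(1,2) by (simp add: \<delta>_def r_def growth_def)
  have "(\<lambda>n. growth t r (w n) - ln r) \<longlonglongrightarrow> growth t r z0 - ln r"
    unfolding growth_def by (intro tendsto_intros w)
  moreover have "growth t r z0 - ln r < - \<delta>"
  proof -
    have "growth t r z0 - ln r = - 2 * \<delta>" by (simp add: \<delta>_def)
    then show ?thesis using \<delta> by simp
  qed
  ultimately have ev: "\<forall>\<^sub>F n in sequentially. growth t r (w n) - ln r < - \<delta>"
    by (rule order_tendstoD(2))
  define C where "C = cmod (of_real (sqrt (1 - t\<^sup>2)) * (1 - (of_real r * of_real t)\<^sup>2) powr (- 1 / 2))"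
  have "(\<lambda>n. 1 - (\<Sum>k<n. index_density t n (p n) (w n) k)) \<longlonglongrightarrow> 0"
  proof (rule real_tendsto_sandwich)
    show "\<forall>\<^sub>F n in sequentially. 0 \<le> 1 - (\<Sum>k<n. index_density t n (p n) (w n) k)"
      using eventually_ge_at_top[of 1]
      by eventually_elim (use elliptic_orthonormal.sum_index_density_le_1[OF orth] in auto)
    show "\<forall>\<^sub>F n in sequentially. 1 - (\<Sum>k<n. index_density t n (p n) (w n) k) \<le> C * exp (- \<delta> * real n)"
      using eventually_ge_at_top[of 1] ev
    proof eventually_elim
      case (elim n)
      have "1 - (\<Sum>k<n. index_density t n (p n) (w n) k) \<le> C * exp (real n * (growth t r (w n) - ln r))"
        unfolding C_def by (rule elliptic_orthonormal.index_density_chernoff[OF orth[OF elim(1)] r])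
      also have "real n * (growth t r (w n) - ln r) \<le> real n * (- \<delta>)"
        using elim by (intro mult_left_mono) auto
      then have "C * exp (real n * (growth t r (w n) - ln r)) \<le> C * exp (- \<delta> * real n)"
        by (intro mult_left_mono) (auto simp: C_def mult.commute)
      finally show ?case .
    qed
    show "(\<lambda>n. C * exp (- \<delta> * real n)) \<longlonglongrightarrow> 0" using \<delta> by real_asymp
  qed auto
  from tendsto_diff[OF tendsto_const[of 1] this] show ?thesis by simp
qed

section \<open>The central limit theorem on the ellipse\<close>

lemma cis_minus_1_asymptotics:
  fixes c :: real
  shows "(\<lambda>n. of_real (sqrt (real n)) * (cis (c / sqrt (real n)) - 1)) \<longlonglongrightarrow> \<i> * of_real c"
    and "(\<lambda>n. of_nat n * (cis (c / sqrt (real n)) - 1 - \<i> * of_real (c / sqrt (real n)))) \<longlonglongrightarrow> - of_real (c\<^sup>2 / 2)"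
proof -
  have "(\<lambda>n. sqrt (real n) * (cos (c / sqrt (real n)) - 1)) \<longlonglongrightarrow> 0" by real_asymp
  moreover have "(\<lambda>n. sqrt (real n) * sin (c / sqrt (real n))) \<longlonglongrightarrow> c" by real_asymp
  ultimately show "(\<lambda>n. of_real (sqrt (real n)) * (cis (c / sqrt (real n)) - 1)) \<longlonglongrightarrow> \<i> * of_real c"
    by (subst tendsto_complex_iff) simp
  have "(\<lambda>n. real n * (cos (c / sqrt (real n)) - 1)) \<longlonglongrightarrow> - (c\<^sup>2 / 2)"
    by (real_asymp simp: power2_eq_square)
  moreover have "(\<lambda>n. real n * (sin (c / sqrt (real n)) - c / sqrt (real n))) \<longlonglongrightarrow> 0" by real_asymp
  ultimately show "(\<lambda>n. of_nat n * (cis (c / sqrt (real n)) - 1 - \<i> * of_real (c / sqrt (real n)))) \<longlonglongrightarrow> - of_real (c\<^sup>2 / 2)"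
    by (subst tendsto_complex_iff) simp
qed

lemma cis_tendsto_1: "(\<lambda>n. cis (c / sqrt (real n))) \<longlonglongrightarrow> 1"
proof -
  have "(\<lambda>n. cis (c / sqrt (real n))) \<longlonglongrightarrow> cis 0"
    by (intro tendsto_intros) real_asymp
  then show ?thesis by simp
qed

lemma one_plus_nonzero:
  assumes "\<bar>T\<bar> < 1" "cmod s \<le> 1"
  shows "1 + of_real T * s \<noteq> 0"
proof
  assume "1 + of_real T * s = 0"
  then have "of_real T * s = -1" by (simp add: add_eq_0_iff)
  then have "\<bar>T\<bar> * cmod s = 1" by (metis norm_minus_cancel norm_mult norm_of_real norm_one)
  moreover have "\<bar>T\<bar> * cmod s \<le> \<bar>T\<bar> * 1" using assms by (intro mult_left_mono) auto
  ultimately show False using assms by simp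
qed

text \<open>A second-order expansion at s = 1 on the scale 1 / sqrt n. The subtracted term of order
  sqrt n records the mean; the limit contains the shift of the mean caused by \<alpha> and the
  variance. The two coordinates of the plane use it with T = t and T = - t.\<close>

lemma growth_asymptotics_axis:
  fixes T c x \<alpha> :: real
  assumes T: "\<bar>T\<bar> < 1"
  defines "s \<equiv> \<lambda>n. cis (c / sqrt (real n))"
  shows "(\<lambda>n. of_nat n * (of_real ((x + \<alpha> / sqrt (real n))\<^sup>2) * (s n / (1 + of_real T * s n) - 1 / (1 + of_real T)))
      - \<i> * of_real (c * x\<^sup>2 * sqrt (real n) / (1 + T)\<^sup>2)) \<longlonglongrightarrow>
    \<i> * of_real (c * (2 * x * \<alpha>) / (1 + T)\<^sup>2) - of_real (c\<^sup>2 / 2 * (x\<^sup>2 * (1 - T) / (1 + T) ^ 3))"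
proof -
  define \<epsilon> where "\<epsilon> = (\<lambda>n. s n - 1)"
  define d where "d = 1 + complex_of_real T"
  have d: "d \<noteq> 0" using one_plus_nonzero[OF T, of 1] by (simp add: d_def)
  have nz: "1 + of_real T * s n \<noteq> 0" for n
    using one_plus_nonzero[OF T, of "s n"] by (simp add: s_def)
  \<comment> \<open>An exact rearrangement for n > 0: apart from a denominator with a nonzero limit,
    s enters only through sqrt n * \<epsilon> and n * (\<epsilon> - \<i> c / sqrt n), which both
    converge, and the terms of order sqrt n have cancelled.\<close>
  define R where "R = (\<lambda>n. of_real ((x + \<alpha> / sqrt (real n))\<^sup>2) *
      (of_nat n * (\<epsilon> n - \<i> * of_real (c / sqrt (real n))) / d\<^sup>2 -
       of_real T * (of_real (sqrt (real n)) * \<epsilon> n)\<^sup>2 / ((1 + of_real T * s n) * d\<^sup>2)) +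
      \<i> * of_real (c * (2 * x * \<alpha> + \<alpha>\<^sup>2 / sqrt (real n))) / d\<^sup>2)"
  have lims: "(\<lambda>n. x + \<alpha> / sqrt (real n)) \<longlonglongrightarrow> x" "(\<lambda>n. c * (2 * x * \<alpha> + \<alpha>\<^sup>2 / sqrt (real n))) \<longlonglongrightarrow> c * (2 * x * \<alpha>)"
    by real_asymp+
  have "R \<longlonglongrightarrow> of_real (x\<^sup>2) *
      (- of_real (c\<^sup>2 / 2) / d\<^sup>2 - of_real T * (\<i> * of_real c)\<^sup>2 / ((1 + of_real T * 1) * d\<^sup>2)) +
      \<i> * of_real (c * (2 * x * \<alpha>)) / d\<^sup>2"
    unfolding R_def \<epsilon>_def s_def
    by (intro tendsto_intros lims cis_minus_1_asymptotics cis_tendsto_1) (use d in \<open>auto simp: d_def\<close>)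
  also have "of_real (x\<^sup>2) *
      (- of_real (c\<^sup>2 / 2) / d\<^sup>2 - of_real T * (\<i> * of_real c)\<^sup>2 / ((1 + of_real T * 1) * d\<^sup>2)) +
      \<i> * of_real (c * (2 * x * \<alpha>)) / d\<^sup>2 =
      \<i> * of_real (c * (2 * x * \<alpha>) / (1 + T)\<^sup>2) - of_real (c\<^sup>2 / 2 * (x\<^sup>2 * (1 - T) / (1 + T) ^ 3))"
  proof -
    have T': "complex_of_real T = d - 1" "1 + (d - 1) = d" by (simp_all add: d_def)
    show ?thesis
      using d by (simp add: T') (simp add: field_simps power2_eq_square power3_eq_cube)
  qed
  finally have lim: "R \<longlonglongrightarrow> \<i> * of_real (c * (2 * x * \<alpha>) / (1 + T)\<^sup>2) - of_real (c\<^sup>2 / 2 * (x\<^sup>2 * (1 - T) / (1 + T) ^ 3))" .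
  have ev: "\<forall>\<^sub>F n in sequentially. R n =
     of_nat n * (of_real ((x + \<alpha> / sqrt (real n))\<^sup>2) * (s n / (1 + of_real T * s n) - 1 / (1 + of_real T)))
      - \<i> * of_real (c * x\<^sup>2 * sqrt (real n) / (1 + T)\<^sup>2)"
    using eventually_gt_at_top[of 0]
  proof eventually_elim
    case (elim n)
    define q where "q = complex_of_real (sqrt (real n))"
    have q: "q \<noteq> 0" "q\<^sup>2 = of_nat n" using elim by (simp_all add: q_def flip: of_real_power)
    define X where "X = complex_of_real (x + \<alpha> / sqrt (real n))"
    have X: "X = of_real x + of_real \<alpha> / q" by (simp add: X_def q_def)
    have "s n / (1 + of_real T * s n) - 1 / d = \<epsilon> n / ((1 + of_real T * s n) * d)"
      using d nz[of n] by (simp add: \<epsilon>_def d_def divide_simps) (simp add: algebra_simps)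
    also have "\<dots> = \<epsilon> n / d\<^sup>2 - of_real T * (\<epsilon> n)\<^sup>2 / ((1 + of_real T * s n) * d\<^sup>2)"
    proof -
      have "1 + of_real T * s n = d + of_real T * \<epsilon> n" by (simp add: d_def \<epsilon>_def algebra_simps)
      then show ?thesis using nz[of n] d
        by (simp add: divide_simps) (simp add: algebra_simps power2_eq_square)
    qed
    finally have G: "s n / (1 + of_real T * s n) - 1 / d = \<epsilon> n / d\<^sup>2 - of_real T * (\<epsilon> n)\<^sup>2 / ((1 + of_real T * s n) * d\<^sup>2)" .
    have "of_nat n * (X\<^sup>2 * (s n / (1 + of_real T * s n) - 1 / d)) - \<i> * (of_real c * (of_real x)\<^sup>2 * q / d\<^sup>2) =
       X\<^sup>2 * (q\<^sup>2 * (\<epsilon> n - \<i> * (of_real c / q)) / d\<^sup>2 - of_real T * (q * \<epsilon> n)\<^sup>2 / ((1 + of_real T * s n) * d\<^sup>2)) +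
       \<i> * of_real c * (X\<^sup>2 * q - (of_real x)\<^sup>2 * q) / d\<^sup>2"
      unfolding G q(2)[symmetric] using q(1) d nz[of n]
      by (simp add: field_simps power2_eq_square)
    also have "X\<^sup>2 * q - (of_real x)\<^sup>2 * q = 2 * of_real x * of_real \<alpha> + (of_real \<alpha>)\<^sup>2 / q"
      unfolding X using q(1) by (simp add: field_simps power2_eq_square)
    finally show ?case
      by (simp add: R_def d_def q(2) X mult.assoc flip: q_def)
  qed
  show ?thesis by (rule Lim_transform_eventually[OF lim ev])
qed

text \<open>On the ellipse the drifts of the two axes add up to c * sqrt n exactly, so the index is
  centred at n. In the limit, \<mu> is the shift of the mean due to v in units of sqrt n, and \<nu>
  is the variance in units of n.\<close>

lemma growth_asymptotics:
  fixes t c :: real and z0 v :: complex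
  assumes t: "0 < t" "t < 1"
    and z0: "(1 - t\<^sup>2) * ((Re z0)\<^sup>2 / (1 + t)\<^sup>2 + (Im z0)\<^sup>2 / (1 - t)\<^sup>2) = 1"
    and \<mu>: "\<mu> = (1 - t\<^sup>2) * (2 * Re z0 * Re v / (1 + t)\<^sup>2 + 2 * Im z0 * Im v / (1 - t)\<^sup>2)"
    and \<nu>: "\<nu> = (1 - t\<^sup>2) * ((Re z0)\<^sup>2 * (1 - t) / (1 + t) ^ 3 + (Im z0)\<^sup>2 * (1 + t) / (1 - t) ^ 3)"
  shows "(\<lambda>n. of_nat n * growth t (cis (c / sqrt (real n))) (z0 + v / of_real (sqrt (real n)))
     - \<i> * of_real (c * sqrt (real n))) \<longlonglongrightarrow> \<i> * of_real (c * \<mu>) - of_real (c\<^sup>2 / 2 * \<nu>)"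
proof -
  have "\<bar>t\<bar> < 1" "\<bar>- t\<bar> < 1" using t by auto
  note lims = growth_asymptotics_axis[OF this(1), of "Re z0" "Re v" c] growth_asymptotics_axis[OF this(2), of "Im z0" "Im v" c]
  have "(\<lambda>n. of_real (1 - t\<^sup>2) *
     ((of_nat n * (of_real ((Re z0 + Re v / sqrt (real n))\<^sup>2) * (cis (c / sqrt (real n)) / (1 + of_real t * cis (c / sqrt (real n))) - 1 / (1 + of_real t)))
      - \<i> * of_real (c * (Re z0)\<^sup>2 * sqrt (real n) / (1 + t)\<^sup>2)) +
      (of_nat n * (of_real ((Im z0 + Im v / sqrt (real n))\<^sup>2) * (cis (c / sqrt (real n)) / (1 + of_real (- t) * cis (c / sqrt (real n))) - 1 / (1 + of_real (- t))))
      - \<i> * of_real (c * (Im z0)\<^sup>2 * sqrt (real n) / (1 + - t)\<^sup>2)))) \<longlonglongrightarrow>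
    of_real (1 - t\<^sup>2) *
     ((\<i> * of_real (c * (2 * Re z0 * Re v) / (1 + t)\<^sup>2) - of_real (c\<^sup>2 / 2 * ((Re z0)\<^sup>2 * (1 - t) / (1 + t) ^ 3))) +
      (\<i> * of_real (c * (2 * Im z0 * Im v) / (1 + - t)\<^sup>2) - of_real (c\<^sup>2 / 2 * ((Im z0)\<^sup>2 * (1 - - t) / (1 + - t) ^ 3))))"
    by (intro tendsto_mult tendsto_const tendsto_add lims)
  also have "of_real (1 - t\<^sup>2) *
     ((\<i> * of_real (c * (2 * Re z0 * Re v) / (1 + t)\<^sup>2) - of_real (c\<^sup>2 / 2 * ((Re z0)\<^sup>2 * (1 - t) / (1 + t) ^ 3))) +
      (\<i> * of_real (c * (2 * Im z0 * Im v) / (1 + - t)\<^sup>2) - of_real (c\<^sup>2 / 2 * ((Im z0)\<^sup>2 * (1 - - t) / (1 + - t) ^ 3)))) =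
      \<i> * of_real (c * \<mu>) - of_real (c\<^sup>2 / 2 * \<nu>)"
  proof -
    define a1 b1 a2 b2 where "a1 = (Re z0)\<^sup>2 * (1 - t) / (1 + t) ^ 3" "b1 = 2 * Re z0 * Re v / (1 + t)\<^sup>2"
      "a2 = (Im z0)\<^sup>2 * (1 + t) / (1 - t) ^ 3" "b2 = 2 * Im z0 * Im v / (1 - t)\<^sup>2"
    have "of_real (1 - t\<^sup>2) * ((\<i> * of_real (c * b1) - of_real (c\<^sup>2 / 2 * a1)) + (\<i> * of_real (c * b2) - of_real (c\<^sup>2 / 2 * a2))) =
      \<i> * of_real (c * ((1 - t\<^sup>2) * (b1 + b2))) - of_real (c\<^sup>2 / 2 * ((1 - t\<^sup>2) * (a1 + a2)))"
      by (simp add: complex_eq_iff field_simps)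
    then show ?thesis
      by (simp only: \<mu> \<nu> a1_b1_a2_b2_def times_divide_eq_right diff_minus_eq_add add_uminus_conv_diff)
  qed
  also have "(\<lambda>n. of_real (1 - t\<^sup>2) *
     ((of_nat n * (of_real ((Re z0 + Re v / sqrt (real n))\<^sup>2) * (cis (c / sqrt (real n)) / (1 + of_real t * cis (c / sqrt (real n))) - 1 / (1 + of_real t)))
      - \<i> * of_real (c * (Re z0)\<^sup>2 * sqrt (real n) / (1 + t)\<^sup>2)) +
      (of_nat n * (of_real ((Im z0 + Im v / sqrt (real n))\<^sup>2) * (cis (c / sqrt (real n)) / (1 + of_real (- t) * cis (c / sqrt (real n))) - 1 / (1 + of_real (- t))))
      - \<i> * of_real (c * (Im z0)\<^sup>2 * sqrt (real n) / (1 + - t)\<^sup>2)))) =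
     (\<lambda>n. of_nat n * growth t (cis (c / sqrt (real n))) (z0 + v / of_real (sqrt (real n)))
     - \<i> * of_real (c * sqrt (real n)))"
  proof
    fix n :: nat
    define A where "A = complex_of_real ((Re z0 + Re v / sqrt (real n))\<^sup>2) * (cis (c / sqrt (real n)) / (1 + of_real t * cis (c / sqrt (real n))) - 1 / (1 + of_real t))"
    define B where "B = complex_of_real ((Im z0 + Im v / sqrt (real n))\<^sup>2) * (cis (c / sqrt (real n)) / (1 - of_real t * cis (c / sqrt (real n))) - 1 / (1 - of_real t))"
    have "of_real (1 - t\<^sup>2) * (\<i> * of_real (c * (Re z0)\<^sup>2 * sqrt (real n) / (1 + t)\<^sup>2) + \<i> * of_real (c * (Im z0)\<^sup>2 * sqrt (real n) / (1 - t)\<^sup>2))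
      = \<i> * of_real (c * sqrt (real n) * ((1 - t\<^sup>2) * ((Re z0)\<^sup>2 / (1 + t)\<^sup>2 + (Im z0)\<^sup>2 / (1 - t)\<^sup>2)))"
    proof -
      define x1 x2 where "x1 = (Re z0)\<^sup>2 / (1 + t)\<^sup>2" "x2 = (Im z0)\<^sup>2 / (1 - t)\<^sup>2"
      have "of_real (1 - t\<^sup>2) * (\<i> * of_real (c * sqrt (real n) * x1) + \<i> * of_real (c * sqrt (real n) * x2)) =
        \<i> * of_real (c * sqrt (real n) * ((1 - t\<^sup>2) * (x1 + x2)))"
        by (simp add: complex_eq_iff algebra_simps)
      then show ?thesis
        by (simp only: x1_x2_def times_divide_eq_right mult.assoc mult.commute[of "sqrt _" "_\<^sup>2"])
    qed
    also have "\<dots> = \<i> * of_real (c * sqrt (real n))" unfolding z0 by simp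
    finally have 1: "of_real (1 - t\<^sup>2) * (\<i> * of_real (c * (Re z0)\<^sup>2 * sqrt (real n) / (1 + t)\<^sup>2) + \<i> * of_real (c * (Im z0)\<^sup>2 * sqrt (real n) / (1 - t)\<^sup>2))
      = \<i> * of_real (c * sqrt (real n))" .
    have 2: "growth t (cis (c / sqrt (real n))) (z0 + v / of_real (sqrt (real n))) = of_real (1 - t\<^sup>2) * (A + B)"
      by (simp add: growth_def A_def B_def)
    have "of_real (1 - t\<^sup>2) * ((of_nat n * A - \<i> * of_real (c * (Re z0)\<^sup>2 * sqrt (real n) / (1 + t)\<^sup>2)) +
        (of_nat n * B - \<i> * of_real (c * (Im z0)\<^sup>2 * sqrt (real n) / (1 - t)\<^sup>2))) =
       of_nat n * (of_real (1 - t\<^sup>2) * (A + B)) - of_real (1 - t\<^sup>2) * (\<i> * of_real (c * (Re z0)\<^sup>2 * sqrt (real n) / (1 + t)\<^sup>2) + \<i> * of_real (c * (Im z0)\<^sup>2 * sqrt (real n) / (1 - t)\<^sup>2))"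
      by (simp only: algebra_simps)
    then have "of_real (1 - t\<^sup>2) * ((of_nat n * A - \<i> * of_real (c * (Re z0)\<^sup>2 * sqrt (real n) / (1 + t)\<^sup>2)) +
        (of_nat n * B - \<i> * of_real (c * (Im z0)\<^sup>2 * sqrt (real n) / (1 - t)\<^sup>2))) =
       of_nat n * growth t (cis (c / sqrt (real n))) (z0 + v / of_real (sqrt (real n)))
     - \<i> * of_real (c * sqrt (real n))"
      unfolding 1 2 .
    then show "of_real (1 - t\<^sup>2) *
     ((of_nat n * (of_real ((Re z0 + Re v / sqrt (real n))\<^sup>2) * (cis (c / sqrt (real n)) / (1 + of_real t * cis (c / sqrt (real n))) - 1 / (1 + of_real t)))
      - \<i> * of_real (c * (Re z0)\<^sup>2 * sqrt (real n) / (1 + t)\<^sup>2)) +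
      (of_nat n * (of_real ((Im z0 + Im v / sqrt (real n))\<^sup>2) * (cis (c / sqrt (real n)) / (1 + of_real (- t) * cis (c / sqrt (real n))) - 1 / (1 + of_real (- t))))
      - \<i> * of_real (c * (Im z0)\<^sup>2 * sqrt (real n) / (1 + - t)\<^sup>2))) =
     of_nat n * growth t (cis (c / sqrt (real n))) (z0 + v / of_real (sqrt (real n)))
     - \<i> * of_real (c * sqrt (real n))"
      by (simp only: A_def B_def of_real_minus mult_minus_left add_uminus_conv_diff)
  qed
  finally show ?thesis .
qed

section \<open>Convergence in distribution of the index on the ellipse\<close>

definition index_pmf :: "real \<Rightarrow> nat \<Rightarrow> (nat \<Rightarrow> complex poly) \<Rightarrow> complex \<Rightarrow> nat pmf" where
  "index_pmf t n p w = embed_pmf (index_density t n p w)"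

context elliptic_orthonormal
begin

lemma pmf_index_pmf: "pmf (index_pmf t n p w) k = index_density t n p w k"
  unfolding index_pmf_def
proof (rule pmf_embed_pmf)
  have "(\<integral>\<^sup>+k. ennreal (index_density t n p w k) \<partial>count_space UNIV) = (\<Sum>k. ennreal (index_density t n p w k))"
    by (rule nn_integral_count_space_nat)
  also have "\<dots> = ennreal (\<Sum>k. index_density t n p w k)"
    by (intro suminf_ennreal2 index_density_nonneg sums_summable[OF index_density_sums])
  also have "(\<Sum>k. index_density t n p w k) = 1" by (rule sums_unique[symmetric, OF index_density_sums])
  finally show "(\<integral>\<^sup>+k. ennreal (index_density t n p w k) \<partial>count_space UNIV) = 1" by simp
qed (rule index_density_nonneg)

lemma measure_index_pmf_lessThan:
  "measure (measure_pmf (index_pmf t n p w)) {..<m} = (\<Sum>k<m. index_density t n p w k)"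
  by (simp add: measure_measure_pmf_finite pmf_index_pmf)

text \<open>On the unit circle the generating function is the characteristic function of the
  index.\<close>

lemma expectation_index_pmf_power:
  assumes "cmod s = 1"
  shows "(\<integral>k. s ^ k \<partial>measure_pmf (index_pmf t n p w)) =
     of_real (sqrt (1 - t\<^sup>2)) * (1 - (s * of_real t)\<^sup>2) powr (- 1 / 2) * exp (of_nat n * growth t s w)"
proof -
  have "(\<integral>k. s ^ k \<partial>measure_pmf (index_pmf t n p w)) =
      (\<integral>k. pmf (index_pmf t n p w) k *\<^sub>R s ^ k \<partial>count_space UNIV)"
    unfolding measure_pmf_eq_density by (subst integral_density) auto
  also have "\<dots> = (\<integral>k. of_real (index_density t n p w k) * s ^ k \<partial>count_space UNIV)"
    by (simp add: pmf_index_pmf scaleR_conv_of_real)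
  also have "\<dots> = (\<Sum>k. of_real (index_density t n p w k) * s ^ k)"
  proof (rule integral_count_space_nat)
    have "summable (index_density t n p w)" by (rule sums_summable[OF index_density_sums])
    then show "integrable (count_space UNIV) (\<lambda>k. of_real (index_density t n p w k) * s ^ k)"
      by (simp add: integrable_count_space_nat_iff norm_mult norm_power assms index_density_nonneg)
  qed
  also have "\<dots> = of_real (sqrt (1 - t\<^sup>2)) * (1 - (s * of_real t)\<^sup>2) powr (- 1 / 2) * exp (of_nat n * growth t s w)"
    by (rule sums_unique[symmetric], rule index_density_pgf) (use t assms in auto)
  finally show ?thesis .
qed

end

lemma isCont_cdf_std_normal: "isCont (cdf std_normal_distribution) x"
proof -
  interpret real_distribution std_normal_distribution by (rule real_dist_normal_dist)
  have "emeasure std_normal_distribution {x} = (\<integral>\<^sup>+y. ennreal (std_normal_density y) * indicator {x} y \<partial>lborel)"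
    by (rule emeasure_density) auto
  also have "\<dots> = 0"
    by (simp add: nn_integral_indicator_singleton')
  finally show ?thesis by (simp add: isCont_cdf measure_def)
qed

text \<open>The index has mean about n + L m sqrt n and standard deviation about L sqrt n, so k < n
  becomes the event that a standard normal variable is at most - m. The characteristic function at
  \<theta> is the generating function at \<open>cis (\<theta> / (L * sqrt n))\<close>, up to the
  phase from centring.\<close>

lemma tendsto_edge:
  fixes t :: real and z0 v :: complex
  assumes t: "0 < t" "t < 1" and orth: "\<And>n. n \<ge> 1 \<Longrightarrow> elliptic_orthonormal t n (p n)"
    and z0: "(1 - t\<^sup>2) * ((Re z0)\<^sup>2 / (1 + t)\<^sup>2 + (Im z0)\<^sup>2 / (1 - t)\<^sup>2) = 1"
    and m: "(1 - t\<^sup>2) * (2 * Re z0 * Re v / (1 + t)\<^sup>2 + 2 * Im z0 * Im v / (1 - t)\<^sup>2) = L * m"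
    and L: "L > 0" "(1 - t\<^sup>2) * ((Re z0)\<^sup>2 * (1 - t) / (1 + t) ^ 3 + (Im z0)\<^sup>2 * (1 + t) / (1 - t) ^ 3) = L\<^sup>2"
  shows "(\<lambda>n. \<Sum>k<n. index_density t n (p n) (z0 + v / of_real (sqrt (real n))) k) \<longlonglongrightarrow>
    cdf std_normal_distribution (- m)"
proof -
  define w where "w = (\<lambda>n. z0 + v / of_real (sqrt (real n)))"
  \<comment> \<open>The added 1 turns \<open>Y n k \<le> - m\<close> into k + 1 <= n, that is k < n,
    for positive n; after scaling it disappears in the limit.\<close>
  define Y where "Y = (\<lambda>n k. (real k + 1 - real n) / (L * sqrt (real n)) - m)"
  \<comment> \<open>\<open>Suc n\<close> keeps the index positive, since the generating function is
    available only for n >= 1.\<close>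
  define M where "M = (\<lambda>n. distr (measure_pmf (index_pmf t (Suc n) (p (Suc n)) (w (Suc n)))) borel (Y (Suc n)))"
  have Ym [measurable]: "Y n \<in> measurable (measure_pmf P) borel" for n P by simp
  have rd: "real_distribution (M n)" for n
    unfolding M_def by (intro prob_space.real_distribution_distr measure_pmf.prob_space_axioms) simp
  have char: "(\<lambda>n. char (M n) \<theta>) \<longlonglongrightarrow> char std_normal_distribution \<theta>" for \<theta>
  proof -
    define c where "c = \<theta> / L"
    define s where "s = (\<lambda>n. cis (c / sqrt (real n)))"
    define F where "F = (\<lambda>n. of_real (sqrt (1 - t\<^sup>2)) * (1 - (s n * of_real t)\<^sup>2) powr (- 1 / 2) *
       exp (of_nat n * growth t (s n) (w n) - \<i> * of_real (c * sqrt (real n))) *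
       exp (\<i> * of_real (c / sqrt (real n) - \<theta> * m)))"
    have char_eq: "char (M n) \<theta> = F (Suc n)" for n
    proof -
      have iexp_add: "iexp (x + real k * (c / sqrt (real (Suc n)))) = exp (\<i> * of_real x) * s (Suc n) ^ k" for x k
        using Complex.DeMoivre[of "c / sqrt (real (Suc n))" k]
        by (simp add: s_def cis_conv_exp exp_add distrib_left)
      let ?P = "index_pmf t (Suc n) (p (Suc n)) (w (Suc n))"
      have "\<theta> * Y (Suc n) k = (c / sqrt (real (Suc n)) - \<theta> * m) - c * sqrt (real (Suc n)) + real k * (c / sqrt (real (Suc n)))" for k
      proof -
        define r where "r = sqrt (real (Suc n))"
        have r: "r > 0" "real (Suc n) = r * r" by (simp_all add: r_def)
        show ?thesis
          unfolding Y_def r_def[symmetric] r(2) c_def using r(1) L(1) by (simp add: field_simps)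
      qed
      then have "iexp (\<theta> * Y (Suc n) k) = exp (\<i> * of_real ((c / sqrt (real (Suc n)) - \<theta> * m) - c * sqrt (real (Suc n)))) * s (Suc n) ^ k" for k
        by (simp only: iexp_add)
      then have "char (M n) \<theta> = (\<integral>k. exp (\<i> * of_real ((c / sqrt (real (Suc n)) - \<theta> * m) - c * sqrt (real (Suc n)))) * s (Suc n) ^ k \<partial>measure_pmf ?P)"
        unfolding char_def M_def by (subst integral_distr) auto
      also have "\<dots> = exp (\<i> * of_real ((c / sqrt (real (Suc n)) - \<theta> * m) - c * sqrt (real (Suc n)))) * (\<integral>k. s (Suc n) ^ k \<partial>measure_pmf ?P)"
        by simp
      also have "(\<integral>k. s (Suc n) ^ k \<partial>measure_pmf ?P) = of_real (sqrt (1 - t\<^sup>2)) * (1 - (s (Suc n) * of_real t)\<^sup>2) powr (- 1 / 2) * exp (of_nat (Suc n) * growth t (s (Suc n)) (w (Suc n)))"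
        by (rule elliptic_orthonormal.expectation_index_pmf_power[OF orth]) (auto simp: s_def)
      finally show ?thesis
        unfolding F_def of_real_diff right_diff_distrib exp_diff by (simp add: mult_ac)
    qed
    have F_lim: "F \<longlonglongrightarrow> of_real (sqrt (1 - t\<^sup>2)) * (1 - (1 * of_real t)\<^sup>2) powr (- 1 / 2) *
       exp (\<i> * of_real (c * (L * m)) - of_real (c\<^sup>2 / 2 * L\<^sup>2)) * exp (\<i> * of_real (0 - \<theta> * m))"
    proof -
      have E: "(\<lambda>n. of_nat n * growth t (s n) (w n) - \<i> * of_real (c * sqrt (real n))) \<longlonglongrightarrow> \<i> * of_real (c * (L * m)) - of_real (c\<^sup>2 / 2 * L\<^sup>2)"
        unfolding s_def w_def by (rule growth_asymptotics[OF t z0 m[symmetric] L(2)[symmetric]])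
      have S: "s \<longlonglongrightarrow> 1" unfolding s_def by (rule cis_tendsto_1)
      have Q: "(\<lambda>n. c / sqrt (real n)) \<longlonglongrightarrow> 0" by real_asymp
      \<comment> \<open>The limit point of the base is positive, hence off the branch cut of the
        complex power.\<close>
      have "1 - t\<^sup>2 > 0" using t by (simp add: power_less_one_iff)
      then have nonpos: "1 - (1 * complex_of_real t)\<^sup>2 \<notin> \<real>\<^sub>\<le>\<^sub>0"
        by (simp add: complex_nonpos_Reals_iff flip: of_real_power)
      have P: "(\<lambda>n. (1 - (s n * of_real t)\<^sup>2) powr (- 1 / 2)) \<longlonglongrightarrow> (1 - (1 * of_real t)\<^sup>2) powr (- 1 / 2)"
        by (intro tendsto_powr_complex tendsto_intros S) (use nonpos in auto)
      have R: "(\<lambda>n. exp (\<i> * of_real (c / sqrt (real n) - \<theta> * m))) \<longlonglongrightarrow> exp (\<i> * of_real (0 - \<theta> * m))"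
        by (intro tendsto_intros Q)
      show ?thesis
        unfolding F_def
        by (rule tendsto_mult[OF tendsto_mult[OF tendsto_mult[OF tendsto_const P] tendsto_exp[OF E]] R])
    qed
    have val: "complex_of_real (sqrt (1 - t\<^sup>2)) * (1 - (1 * of_real t)\<^sup>2) powr (- 1 / 2) *
       exp (\<i> * of_real (c * (L * m)) - of_real (c\<^sup>2 / 2 * L\<^sup>2)) * exp (\<i> * of_real (0 - \<theta> * m)) = char std_normal_distribution \<theta>"
    proof -
      have c: "c * (L * m) = \<theta> * m" "c\<^sup>2 / 2 * L\<^sup>2 = \<theta>\<^sup>2 / 2" using L(1) by (simp_all add: c_def power_divide)
      note pgf_normalization[OF t]
      then show ?thesis
        unfolding c char_std_normal_distribution by (simp add: exp_of_real[symmetric] exp_diff exp_minus field_simps flip: exp_add)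
    qed
    show ?thesis
      unfolding char_eq val[symmetric] by (rule LIMSEQ_Suc[OF F_lim])
  qed
  have "weak_conv_m M std_normal_distribution"
    by (rule levy_continuity[OF rd real_dist_normal_dist char])
  then have "(\<lambda>n. cdf (M n) (- m)) \<longlonglongrightarrow> cdf std_normal_distribution (- m)"
    using isCont_cdf_std_normal by (auto simp: weak_conv_m_def weak_conv_def)
  moreover have "cdf (M n) (- m) = (\<Sum>k<Suc n. index_density t (Suc n) (p (Suc n)) (w (Suc n)) k)" for n
  proof -
    define D where "D = L * sqrt (real (Suc n))"
    have D: "D > 0" using L(1) by (simp add: D_def)
    have "Y (Suc n) k \<le> - m \<longleftrightarrow> (real k + 1 - real (Suc n)) / D \<le> 0" for k
      by (simp add: Y_def D_def)
    also have "\<dots> k \<longleftrightarrow> k < Suc n" for k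
      using D by (auto simp: divide_le_0_iff)
    finally have "Y (Suc n) -` {..- m} = {..<Suc n}" by auto
    then show ?thesis
      using elliptic_orthonormal.measure_index_pmf_lessThan[OF orth, of "Suc n" "w (Suc n)" "Suc n"]
      by (simp add: cdf_def M_def measure_distr)
  qed
  ultimately have "(\<lambda>n. \<Sum>k<Suc n. index_density t (Suc n) (p (Suc n)) (w (Suc n)) k) \<longlonglongrightarrow> cdf std_normal_distribution (- m)"
    by simp
  then show ?thesis
    unfolding w_def by (rule LIMSEQ_imp_Suc)
qed

text \<open>The angle is that of the outward normal. The gradient of the form at z0 is proportional
  to (cos \<phi> / a_t, sin \<phi> / b_t), which is (b_t cos \<phi>, a_t sin \<phi>) because a_t b_t
  = 1. L is the length of the latter vector, and the cases of \<open>normal_angle\<close> select the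
  branch of the arctangent.\<close>

lemma normal_angle_direction:
  assumes t: "0 < t" "t < 1" and \<phi>: "- pi < \<phi>" "\<phi> \<le> pi"
  obtains L where "L > 0"
    "of_real L * exp (\<i> * of_real (normal_angle t \<phi>)) = Complex (semiaxis_b t * cos \<phi>) (semiaxis_a t * sin \<phi>)"
proof -
  define A B where "A = semiaxis_a t" "B = semiaxis_b t"
  have AB: "A > 0" "B > 0" using t by (simp_all add: A_B_def semiaxis_a_def semiaxis_b_def)
  have sq: "A\<^sup>2 = (1 + t) / (1 - t)" and 1: "A * B = 1"
    using t by (simp_all add: A_B_def semiaxis_a_def semiaxis_b_def flip: real_sqrt_mult)
  have "A\<^sup>2 * B = A" using 1 by (simp add: power2_eq_square mult.assoc)
  then have \<rho>: "(1 + t) / (1 - t) * B = A" unfolding sq .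
  define \<psi> where "\<psi> = arctan ((1 + t) / (1 - t) * tan \<phi>)"
  define S where "S = sqrt (1 + ((1 + t) / (1 - t) * tan \<phi>)\<^sup>2)"
  have S: "S > 0" by (simp add: S_def add_pos_nonneg)
  have cs: "cos \<psi> = 1 / S" "sin \<psi> = (1 + t) / (1 - t) * tan \<phi> / S"
    by (simp_all add: \<psi>_def S_def cos_arctan sin_arctan)
  \<comment> \<open>The arctangent yields only directions with positive real part. For cos \<phi> <
    0 the scalar in front is negative, and the added \<open>sgn \<phi> * pi\<close> reverses the
    direction to make it positive.\<close>
  have main: "of_real (B * cos \<phi> * S) * cis \<psi> = Complex (B * cos \<phi>) (A * sin \<phi>)" if "cos \<phi> \<noteq> 0"
  proof -
    have "B * cos \<phi> * S * cos \<psi> = B * cos \<phi>" using S by (simp add: cs)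
    moreover have "B * cos \<phi> * S * sin \<psi> = (1 + t) / (1 - t) * B * (cos \<phi> * tan \<phi>)" using S by (simp add: cs)
    then have "B * cos \<phi> * S * sin \<psi> = A * sin \<phi>" unfolding \<rho> using that by (simp add: tan_def)
    ultimately show ?thesis by (simp add: complex_eq_iff)
  qed
  consider "\<phi> \<in> {- (pi / 2)<..<pi / 2}" | "\<phi> \<notin> {- (pi / 2)..pi / 2}" | "\<phi> = pi / 2" | "\<phi> = - (pi / 2)"
    by (smt (verit) greaterThanLessThan_iff atLeastAtMost_iff)
  then show ?thesis
  proof cases
    case 1
    then have c: "cos \<phi> > 0" by (intro cos_gt_zero_pi) auto
    have "normal_angle t \<phi> = \<psi>" using 1 by (simp add: normal_angle_def \<psi>_def)
    then show ?thesis
      using main c AB S by (intro that[of "B * cos \<phi> * S"]) (auto simp: A_B_def cis_conv_exp)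
  next
    case 2
    have c: "cos \<phi> < 0"
    proof -
      have "cos (pi - \<bar>\<phi>\<bar>) > 0" using 2 \<phi> by (intro cos_gt_zero_pi) auto
      then show ?thesis by simp
    qed
    have not1: "\<phi> \<notin> {- (pi / 2)<..<pi / 2}" and "\<phi> \<noteq> 0" using 2 by auto
    have "normal_angle t \<phi> = \<psi> + sgn \<phi> * pi"
      by (simp only: normal_angle_def \<psi>_def not1 2 if_False if_True not_False_eq_True)
    moreover have "sgn \<phi> = 1 \<or> sgn \<phi> = -1" using \<open>\<phi> \<noteq> 0\<close> by (auto simp: sgn_if)
    then have "cis (\<psi> + sgn \<phi> * pi) = - cis \<psi>" by (auto simp: complex_eq_iff)
    ultimately have "exp (\<i> * of_real (normal_angle t \<phi>)) = - cis \<psi>"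
      by (simp only: cis_conv_exp)
    then have "of_real (- (B * cos \<phi> * S)) * exp (\<i> * of_real (normal_angle t \<phi>)) = Complex (B * cos \<phi>) (A * sin \<phi>)"
      using main c by simp
    moreover have "- (B * cos \<phi> * S) > 0" using c AB S by (simp add: mult_less_0_iff mult_pos_neg)
    ultimately show ?thesis unfolding A_B_def by (rule that[rotated])
  next
    case 3
    have "normal_angle t \<phi> = pi / 2" unfolding normal_angle_def 3 using pi_gt_zero by auto
    then have "exp (\<i> * of_real (normal_angle t \<phi>)) = \<i>" by (simp only: cis_conv_exp[symmetric] cis_pi_half)
    moreover have "cos \<phi> = 0" "sin \<phi> = 1" by (simp_all add: 3)
    ultimately have "of_real A * exp (\<i> * of_real (normal_angle t \<phi>)) = Complex (B * cos \<phi>) (A * sin \<phi>)"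
      by (simp only: complex_eq_iff) simp
    with AB(1) show ?thesis unfolding A_B_def by (rule that)
  next
    case 4
    have "normal_angle t \<phi> = - (pi / 2)" unfolding normal_angle_def 4 using pi_gt_zero by auto
    moreover have "cis (- (pi / 2)) = - \<i>" by (simp add: complex_eq_iff)
    ultimately have "exp (\<i> * of_real (normal_angle t \<phi>)) = - \<i>" by (simp only: cis_conv_exp[symmetric])
    moreover have "cos \<phi> = 0" "sin \<phi> = - 1" by (simp_all add: 4)
    ultimately have "of_real A * exp (\<i> * of_real (normal_angle t \<phi>)) = Complex (B * cos \<phi>) (A * sin \<phi>)"
      by (simp only: complex_eq_iff) simp
    with AB(1) show ?thesis unfolding A_B_def by (rule that)
  qed
qed

text \<open>The gradient of the quadratic form at z0 is 2 L \<omega>, so a displacement a \<omega>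
  is felt only through \<open>Re a\<close>, and its tangential part drops out. The variance is the
  squared length of the same vector L \<omega>, so the shift measured in standard deviations is
  \<open>2 * Re a\<close>.\<close>

lemma normal_direction:
  assumes t: "0 < t" "t < 1" and \<omega>: "cmod \<omega> = 1" and L: "L > 0"
    and dir: "of_real L * \<omega> = Complex (semiaxis_b t * cos \<phi>) (semiaxis_a t * sin \<phi>)"
    and z0: "z0 = of_real (semiaxis_a t * cos \<phi>) + \<i> * of_real (semiaxis_b t * sin \<phi>)"
  shows "(1 - t\<^sup>2) * (2 * Re z0 * Re (a * \<omega>) / (1 + t)\<^sup>2 + 2 * Im z0 * Im (a * \<omega>) / (1 - t)\<^sup>2) = L * (2 * Re a)"
    and "(1 - t\<^sup>2) * ((Re z0)\<^sup>2 * (1 - t) / (1 + t) ^ 3 + (Im z0)\<^sup>2 * (1 + t) / (1 - t) ^ 3) = L\<^sup>2"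
proof -
  define A B where "A = semiaxis_a t" "B = semiaxis_b t"
  have sq: "A\<^sup>2 = (1 + t) / (1 - t)" "B\<^sup>2 = (1 - t) / (1 + t)" and AB: "A * B = 1"
    using t by (simp_all add: A_B_def semiaxis_a_def semiaxis_b_def flip: real_sqrt_mult)
  have "B\<^sup>2 * A = B" "A\<^sup>2 * B = A" using AB by (simp_all add: power2_eq_square mult.assoc mult.commute[of B A])
  then have BA: "(1 - t) / (1 + t) * A = B" "(1 + t) / (1 - t) * B = A" unfolding sq by auto
  have z: "Re z0 = A * cos \<phi>" "Im z0 = B * sin \<phi>" by (simp_all add: z0 A_B_def)
  have N: "L * Re \<omega> = B * cos \<phi>" "L * Im \<omega> = A * sin \<phi>"
    using dir by (simp_all add: complex_eq_iff A_B_def)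
  have e: "1 - t\<^sup>2 = (1 + t) * (1 - t)" by (simp add: power2_eq_square algebra_simps)
  have 1: "(1 - t\<^sup>2) * (x / (1 + t)\<^sup>2) = (1 - t) / (1 + t) * x" "(1 - t\<^sup>2) * (x / (1 - t)\<^sup>2) = (1 + t) / (1 - t) * x" for x
    unfolding e using t by (simp_all add: power2_eq_square)
  define \<alpha> \<beta> where "\<alpha> = Re (a * \<omega>)" "\<beta> = Im (a * \<omega>)"
  have "(1 - t\<^sup>2) * (2 * Re z0 * Re (a * \<omega>) / (1 + t)\<^sup>2 + 2 * Im z0 * Im (a * \<omega>) / (1 - t)\<^sup>2) =
     2 * (((1 - t) / (1 + t) * A) * cos \<phi> * \<alpha> + ((1 + t) / (1 - t) * B) * sin \<phi> * \<beta>)"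
    unfolding distrib_left[of "1 - t\<^sup>2"] 1 z \<alpha>_\<beta>_def[symmetric] by (simp add: algebra_simps)
  also have "\<dots> = 2 * ((L * Re \<omega>) * \<alpha> + (L * Im \<omega>) * \<beta>)"
    unfolding BA N by simp
  also have "\<dots> = 2 * L * Re a * ((Re \<omega>)\<^sup>2 + (Im \<omega>)\<^sup>2)"
    by (simp add: \<alpha>_\<beta>_def algebra_simps power2_eq_square)
  also have \<omega>_sq: "(Re \<omega>)\<^sup>2 + (Im \<omega>)\<^sup>2 = 1" using \<omega> by (simp flip: cmod_power2)
  finally show "(1 - t\<^sup>2) * (2 * Re z0 * Re (a * \<omega>) / (1 + t)\<^sup>2 + 2 * Im z0 * Im (a * \<omega>) / (1 - t)\<^sup>2) = L * (2 * Re a)"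
    by simp
  have "L\<^sup>2 = (L * Re \<omega>)\<^sup>2 + (L * Im \<omega>)\<^sup>2"
    using \<omega>_sq by (simp add: power_mult_distrib flip: distrib_left)
  also have "\<dots> = B\<^sup>2 * (cos \<phi>)\<^sup>2 + A\<^sup>2 * (sin \<phi>)\<^sup>2"
    unfolding N by (simp add: power_mult_distrib)
  also have "\<dots> = (1 - t) / (1 + t) * (cos \<phi>)\<^sup>2 + (1 + t) / (1 - t) * (sin \<phi>)\<^sup>2"
    unfolding sq ..
  also have "(1 - t) / (1 + t) * (cos \<phi>)\<^sup>2 = (1 - t\<^sup>2) * ((Re z0)\<^sup>2 * (1 - t) / (1 + t) ^ 3)"
    unfolding z power_mult_distrib sq e using t by (simp add: power3_eq_cube)
  also have "(1 + t) / (1 - t) * (sin \<phi>)\<^sup>2 = (1 - t\<^sup>2) * ((Im z0)\<^sup>2 * (1 + t) / (1 - t) ^ 3)"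
    unfolding z power_mult_distrib sq e using t by (simp add: power3_eq_cube)
  finally show "(1 - t\<^sup>2) * ((Re z0)\<^sup>2 * (1 - t) / (1 + t) ^ 3 + (Im z0)\<^sup>2 * (1 + t) / (1 - t) ^ 3) = L\<^sup>2"
    by (simp add: distrib_left)
qed

section \<open>The rescaled kernel\<close>

lemma norm_sum_cnj_mult_le:
  "cmod (\<Sum>k\<in>A. cnj (x k) * y k) \<le> ((\<Sum>k\<in>A. (cmod (x k))\<^sup>2) + (\<Sum>k\<in>A. (cmod (y k))\<^sup>2)) / 2"
proof -
  have "cmod (\<Sum>k\<in>A. cnj (x k) * y k) \<le> (\<Sum>k\<in>A. cmod (x k) * cmod (y k))"
    by (rule order.trans[OF norm_sum]) (simp add: norm_mult)
  also have "\<dots> \<le> (\<Sum>k\<in>A. ((cmod (x k))\<^sup>2 + (cmod (y k))\<^sup>2) / 2)"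
  proof (rule sum_mono)
    show "cmod (x k) * cmod (y k) \<le> ((cmod (x k))\<^sup>2 + (cmod (y k))\<^sup>2) / 2" for k
      using sum_squares_bound[of "cmod (x k)" "cmod (y k)"] by simp
  qed
  finally show ?thesis by (simp add: sum.distrib sum_divide_distrib[symmetric])
qed

text \<open>The weight \<open>exp (- n V / 2)\<close> is not holomorphic in the rescaled variable \<open>v\<close>, but it differs only by
  a phase and the factor \<open>exp (- \<bar>v\<bar>\<^sup>2 / 2)\<close> from the following entire function.\<close>

definition phase_gauge :: "real \<Rightarrow> complex \<Rightarrow> complex \<Rightarrow> nat \<Rightarrow> complex \<Rightarrow> complex" where
  "phase_gauge t z0 \<omega> n v = exp (- of_nat n / 2 * (of_real ((cmod z0)\<^sup>2) + 2 * cnj z0 * (v * \<omega> / of_real (sqrt (real n)))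
     - of_real t * (z0 + v * \<omega> / of_real (sqrt (real n)))\<^sup>2))"

text \<open>With y the displacement from z0, every term of the expanded potential except |y|^2 is
  the real part of a function holomorphic in y. The gauge uses that function and omits |y|^2, whose
  n-fold is |v|^2.\<close>

lemma cmod_phase_gauge:
  assumes \<omega>: "cmod \<omega> = 1" and n: "n \<ge> 1"
  shows "cmod (phase_gauge t z0 \<omega> n v) =
    exp ((cmod v)\<^sup>2 / 2) * exp (- (real n / 2) * elliptic_potential t (z0 + v * \<omega> / of_real (sqrt (real n))))"
proof -
  define y where "y = v * \<omega> / of_real (sqrt (real n))"
  have "cmod y = cmod v / sqrt (real n)" using \<omega> by (simp add: y_def norm_mult norm_divide)
  then have y: "real n * (cmod y)\<^sup>2 = (cmod v)\<^sup>2" using n by (simp add: power_divide)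
  have V: "elliptic_potential t (z0 + y) = (cmod z0)\<^sup>2 + 2 * Re (cnj z0 * y) + (cmod y)\<^sup>2 - Re (of_real t * (z0 + y)\<^sup>2)"
    unfolding elliptic_potential_def cmod_power2 by (simp add: power2_eq_square algebra_simps)
  have "Re (- of_nat n / 2 * (of_real ((cmod z0)\<^sup>2) + 2 * cnj z0 * y - of_real t * (z0 + y)\<^sup>2)) =
     - (real n / 2) * ((cmod z0)\<^sup>2 + 2 * Re (cnj z0 * y) - Re (of_real t * (z0 + y)\<^sup>2))"
  proof -
    define Z where "Z = of_real ((cmod z0)\<^sup>2) + 2 * cnj z0 * y - of_real t * (z0 + y)\<^sup>2"
    have "Re Z = (cmod z0)\<^sup>2 + 2 * Re (cnj z0 * y) - Re (of_real t * (z0 + y)\<^sup>2)"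
      by (simp add: Z_def)
    moreover have "Re (- of_nat n / 2 * Z) = - (real n / 2) * Re Z" by simp
    ultimately show ?thesis by (simp only: Z_def)
  qed
  also have "\<dots> = real n * (cmod y)\<^sup>2 / 2 - (real n / 2) * elliptic_potential t (z0 + y)"
    unfolding V by (simp add: field_simps)
  finally have Re_eq: "Re (- of_nat n / 2 * (of_real ((cmod z0)\<^sup>2) + 2 * cnj z0 * y - of_real t * (z0 + y)\<^sup>2)) =
     real n * (cmod y)\<^sup>2 / 2 - (real n / 2) * elliptic_potential t (z0 + y)" .
  show ?thesis
    unfolding phase_gauge_def y_def[symmetric] norm_exp_eq_Re exp_add[symmetric] Re_eq y by simp
qed

text \<open>F is the limiting probability on the diagonal and H polarises
  \<open>exp ((cmod a)\<^sup>2) * F a\<close>. The exponential comes from the gauge and is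
  compensated by the Gaussian prefactor in the conclusion.\<close>

lemma kernel_limit:
  fixes t :: real and z0 \<omega> a b :: complex and H :: "complex \<Rightarrow> complex \<Rightarrow> complex"
  assumes orth: "\<And>n. n \<ge> 1 \<Longrightarrow> elliptic_orthonormal t n (p n)" and \<omega>: "cmod \<omega> = 1"
    and H: "\<And>\<alpha> \<beta> \<gamma> \<delta>. (\<lambda>x. H (\<alpha> * x + \<beta>) (\<gamma> * x + \<delta>)) holomorphic_on UNIV"
    and diag: "\<And>a. (\<lambda>n. \<Sum>k<n. index_density t n (p n) (z0 + a * \<omega> / of_real (sqrt (real n))) k) \<longlonglongrightarrow> F a"
    and HF: "\<And>a. H (cnj a) a = of_real (exp ((cmod a)\<^sup>2) * F a)"
  shows "(\<lambda>n. cmod (1 / of_nat n * reproducing_kernel (elliptic_potential t) n (p n)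
           (z0 + a * \<omega> / of_real (sqrt (real n))) (z0 + b * \<omega> / of_real (sqrt (real n)))))
         \<longlonglongrightarrow> 1 / pi * exp (- ((cmod a)\<^sup>2 + (cmod b)\<^sup>2) / 2) * cmod (H (cnj a) b)"
proof -
  define w where "w = (\<lambda>n v. z0 + v * \<omega> / of_real (sqrt (real n)))"
  define P where "P = (\<lambda>n k v. poly (p n k) (w n v) * phase_gauge t z0 \<omega> n v)"
  \<comment> \<open>Conjugating both u and the value makes \<open>G\<close> holomorphic in u as well
    as in v; the kernel for the pair a, b appears at \<open>u = cnj a\<close>,
    \<open>v = b\<close>.\<close>
  define G where "G = (\<lambda>n u v. of_real (pi / real n) * (\<Sum>k<n. cnj (P n k (cnj u)) * P n k v))"
  have P_hol: "(\<lambda>x. P n k (\<alpha> * x + \<beta>)) holomorphic_on UNIV" for n k \<alpha> \<beta>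
    unfolding P_def w_def phase_gauge_def by (intro holomorphic_intros) auto
  have cmod_P: "pi / real n * (cmod (P n k v))\<^sup>2 = exp ((cmod v)\<^sup>2) * index_density t n (p n) (w n v) k" if "n \<ge> 1" for n k v
  proof -
    have "(cmod (phase_gauge t z0 \<omega> n v))\<^sup>2 = exp ((cmod v)\<^sup>2) * exp (- real n * elliptic_potential t (w n v))"
      unfolding cmod_phase_gauge[OF \<omega> that] w_def by (simp add: power_mult_distrib flip: exp_double)
    then show ?thesis
      by (simp add: P_def index_density_def norm_mult power_mult_distrib)
  qed
  have sum_P: "pi / real n * (\<Sum>k<n. (cmod (P n k v))\<^sup>2) = exp ((cmod v)\<^sup>2) * (\<Sum>k<n. index_density t n (p n) (w n v) k)" if "n \<ge> 1" for n v
    unfolding sum_distrib_left cmod_P[OF that] ..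
  have "(\<lambda>n. G n u v) \<longlonglongrightarrow> H u v" for u v
  proof (rule polarization_limit[where G = G and H = H])
    show "(\<lambda>x. H (\<alpha> * x + \<beta>) (\<gamma> * x + \<delta>)) holomorphic_on UNIV" for \<alpha> \<beta> \<gamma> \<delta>
      by (rule H)
    show "(\<lambda>x. G n (\<alpha> * x + \<beta>) (\<gamma> * x + \<delta>)) holomorphic_on UNIV" for n \<alpha> \<beta> \<gamma> \<delta>
    proof -
      have "(\<lambda>x. cnj (P n k (cnj (\<alpha> * x + \<beta>)))) holomorphic_on UNIV" for k
      proof -
        have "(\<lambda>x. P n k (cnj \<alpha> * x + cnj \<beta>)) holomorphic_on cnj ` UNIV"
          by (rule holomorphic_on_subset[OF P_hol]) simp
        from holomorphic_on_compose_cnj_cnj[OF this] show ?thesis by (simp add: o_def)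
      qed
      then show ?thesis
        unfolding G_def by (intro holomorphic_intros P_hol)
    qed
    show "\<exists>B. \<forall>n u v. cmod u \<le> R \<longrightarrow> cmod v \<le> R \<longrightarrow> cmod (G n u v) \<le> B" for R
    proof (intro exI allI impI)
      fix n u v assume uv: "cmod u \<le> R" "cmod v \<le> R"
      \<comment> \<open>The inequality 2 x y <= x^2 + y^2 reduces the bound to the diagonal, where
        the probability is at most 1. For n = 0 the sum is empty.\<close>
      show "cmod (G n u v) \<le> exp (R\<^sup>2)"
      proof (cases "n = 0")
        case False
        then have n: "n \<ge> 1" by simp
        have b: "pi / real n * (\<Sum>k<n. (cmod (P n k v))\<^sup>2) \<le> exp (R\<^sup>2)" if "cmod v \<le> R" for v
        proof -
          have "exp ((cmod v)\<^sup>2) * (\<Sum>k<n. index_density t n (p n) (w n v) k) \<le> exp (R\<^sup>2) * 1"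
            using that by (intro mult_mono elliptic_orthonormal.sum_index_density_le_1[OF orth[OF n]])
              (auto intro: sum_nonneg index_density_nonneg power_mono)
          then show ?thesis unfolding sum_P[OF n] by simp
        qed
        have "cmod (G n u v) = pi / real n * cmod (\<Sum>k<n. cnj (P n k (cnj u)) * P n k v)"
          by (simp add: G_def norm_mult norm_divide)
        also have "\<dots> \<le> pi / real n * (((\<Sum>k<n. (cmod (P n k (cnj u)))\<^sup>2) + (\<Sum>k<n. (cmod (P n k v))\<^sup>2)) / 2)"
          by (intro mult_left_mono norm_sum_cnj_mult_le) auto
        also have "\<dots> = (pi / real n * (\<Sum>k<n. (cmod (P n k (cnj u)))\<^sup>2) + pi / real n * (\<Sum>k<n. (cmod (P n k v))\<^sup>2)) / 2"
          by (simp add: algebra_simps)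
        also have "\<dots> \<le> exp (R\<^sup>2)"
          using b[of "cnj u"] b[of v] uv by simp
        finally show ?thesis .
      qed (simp add: G_def)
    qed
    show "(\<lambda>n. G n (cnj a) a) \<longlonglongrightarrow> H (cnj a) a" for a
    proof (rule Lim_transform_eventually)
      show "(\<lambda>n. of_real (exp ((cmod a)\<^sup>2) * (\<Sum>k<n. index_density t n (p n) (w n a) k))) \<longlonglongrightarrow> H (cnj a) a"
        unfolding HF w_def by (intro tendsto_of_real tendsto_mult tendsto_const diag)
      show "\<forall>\<^sub>F n in sequentially. complex_of_real (exp ((cmod a)\<^sup>2) * (\<Sum>k<n. index_density t n (p n) (w n a) k)) = G n (cnj a) a"
        using eventually_ge_at_top[of 1]
      proof eventually_elim
        case (elim n)
        have "cnj x * x = of_real ((cmod x)\<^sup>2)" for x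
          using complex_norm_square[of x] by (simp add: mult.commute)
        then show ?case
          by (simp add: G_def flip: sum_P[OF elim])
      qed
    qed
  qed
  then have "(\<lambda>n. 1 / pi * exp (- ((cmod a)\<^sup>2 + (cmod b)\<^sup>2) / 2) * cmod (G n (cnj a) b)) \<longlonglongrightarrow>
     1 / pi * exp (- ((cmod a)\<^sup>2 + (cmod b)\<^sup>2) / 2) * cmod (H (cnj a) b)"
    by (intro tendsto_intros)
  moreover have "\<forall>\<^sub>F n in sequentially. 1 / pi * exp (- ((cmod a)\<^sup>2 + (cmod b)\<^sup>2) / 2) * cmod (G n (cnj a) b) =
     cmod (1 / of_nat n * reproducing_kernel (elliptic_potential t) n (p n) (w n a) (w n b))"
    using eventually_ge_at_top[of 1]
  proof eventually_elim
    case (elim n)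
    define S where "S = (\<Sum>k<n. cnj (poly (p n k) (w n a)) * poly (p n k) (w n b))"
    have "G n (cnj a) b = of_real (pi / real n) * (cnj (phase_gauge t z0 \<omega> n a) * phase_gauge t z0 \<omega> n b * S)"
      by (simp add: G_def P_def S_def sum_distrib_left mult_ac)
    then have "cmod (G n (cnj a) b) = pi / real n * (cmod (phase_gauge t z0 \<omega> n a) * cmod (phase_gauge t z0 \<omega> n b) * cmod S)"
      by (simp add: norm_mult norm_divide)
    also have "cmod (phase_gauge t z0 \<omega> n a) * cmod (phase_gauge t z0 \<omega> n b) =
       exp (((cmod a)\<^sup>2 + (cmod b)\<^sup>2) / 2) * exp (- (real n / 2 * (elliptic_potential t (w n a) + elliptic_potential t (w n b))))"
      unfolding cmod_phase_gauge[OF \<omega> elim] w_def exp_add[symmetric] by (simp add: field_simps)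
    finally have G_eq: "cmod (G n (cnj a) b) = pi * exp (((cmod a)\<^sup>2 + (cmod b)\<^sup>2) / 2) *
       (1 / real n * (exp (- (real n / 2 * (elliptic_potential t (w n a) + elliptic_potential t (w n b)))) * cmod S))"
      by (simp add: mult_ac)
    have cancel: "1 / pi * exp (- ((cmod a)\<^sup>2 + (cmod b)\<^sup>2) / 2) * (pi * exp (((cmod a)\<^sup>2 + (cmod b)\<^sup>2) / 2) * X) = X" for X :: real
    proof -
      have "exp (- ((cmod a)\<^sup>2 + (cmod b)\<^sup>2) / 2) * exp (((cmod a)\<^sup>2 + (cmod b)\<^sup>2) / 2) = 1"
        unfolding exp_add[symmetric] by (simp add: field_simps)
      then show ?thesis by (simp add: mult_ac)
    qed
    have K_eq: "cmod (1 / of_nat n * reproducing_kernel (elliptic_potential t) n (p n) (w n a) (w n b)) =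
       1 / real n * (exp (- (real n / 2 * (elliptic_potential t (w n a) + elliptic_potential t (w n b)))) * cmod S)"
      by (simp add: reproducing_kernel_def norm_mult norm_divide flip: S_def)
    show ?case unfolding G_eq cancel K_eq ..
  qed
  ultimately have "(\<lambda>n. cmod (1 / of_nat n * reproducing_kernel (elliptic_potential t) n (p n) (w n a) (w n b)))
     \<longlonglongrightarrow> 1 / pi * exp (- ((cmod a)\<^sup>2 + (cmod b)\<^sup>2) / 2) * cmod (H (cnj a) b)"
    by (rule Lim_transform_eventually)
  then show ?thesis by (simp add: w_def)
qed

lemma gaussian_modulus:
  "exp (- ((cmod a)\<^sup>2 + (cmod b)\<^sup>2) / 2) * cmod (exp (cnj a * b)) = exp (- (cmod (a - b))\<^sup>2 / 2)"
proof -
  have "- ((cmod a)\<^sup>2 + (cmod b)\<^sup>2) / 2 + Re (cnj a * b) = - (cmod (a - b))\<^sup>2 / 2"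
    unfolding cmod_power2 by (simp add: power2_eq_square field_simps)
  then show ?thesis by (simp only: norm_exp_eq_Re exp_add[symmetric])
qed

theorem theorem8p15:
  fixes t :: real and a b :: complex and p :: "nat \<Rightarrow> nat \<Rightarrow> complex poly"
  assumes "0 < t" and "t < 1"
    and "\<And>n. n \<ge> 1 \<Longrightarrow> orthonormal_polys (elliptic_potential t) n (p n)"
  defines "K \<equiv> \<lambda>n. reproducing_kernel (elliptic_potential t) n (p n)"
  shows "(\<forall>z0 \<in> ellipse_inside t.
           (\<lambda>n. cmod (1 / of_nat n *
                  K n (z0 + a / of_real (sqrt (real n))) (z0 + b / of_real (sqrt (real n)))))
           \<longlonglongrightarrow> 1 / pi * exp (- (cmod (a - b))\<^sup>2 / 2)) \<and>
         (\<forall>z0 \<in> ellipse t. \<forall>\<phi> \<in> {-pi<..pi}.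
           z0 = of_real (semiaxis_a t * cos \<phi>) + \<i> * of_real (semiaxis_b t * sin \<phi>) \<longrightarrow>
           (\<lambda>n. cmod (1 / of_nat n *
                  K n (z0 + a * exp (\<i> * of_real (normal_angle t \<phi>)) / of_real (sqrt (real n)))
                      (z0 + b * exp (\<i> * of_real (normal_angle t \<phi>)) / of_real (sqrt (real n)))))
           \<longlonglongrightarrow> 1 / (2 * pi) * exp (- (cmod (a - b))\<^sup>2 / 2)
                 * cmod (erfc ((cnj a + b) / of_real (sqrt 2))))"
proof (intro conjI ballI impI)
  have t: "0 < t" "t < 1" by fact+
  have orth: "elliptic_orthonormal t n (p n)" if "n \<ge> 1" for n
    using assms that by unfold_locales auto
  {
    fix z0 assume z0: "z0 \<in> ellipse_inside t"
    have "(\<lambda>n. cmod (1 / of_nat n * K n (z0 + a * 1 / of_real (sqrt (real n))) (z0 + b * 1 / of_real (sqrt (real n)))))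
      \<longlonglongrightarrow> 1 / pi * exp (- ((cmod a)\<^sup>2 + (cmod b)\<^sup>2) / 2) * cmod (exp (cnj a * b))"
      unfolding K_def
    \<comment> \<open>Here \<omega> = 1, and exp (u v) polarises exp (|a|^2).\<close>
    proof (rule kernel_limit[OF orth, where F = "\<lambda>_. 1" and H = "\<lambda>u v. exp (u * v)"])
      show "(\<lambda>x. exp ((\<alpha> * x + \<beta>) * (\<gamma> * x + \<delta>))) holomorphic_on UNIV" for \<alpha> \<beta> \<gamma> \<delta> :: complex
        by (intro holomorphic_intros)
      show "(\<lambda>n. \<Sum>k<n. index_density t n (p n) (z0 + a * 1 / of_real (sqrt (real n))) k) \<longlonglongrightarrow> 1" for a
      proof (rule tendsto_interior[OF t orth z0])
        have "(\<lambda>n. 1 / sqrt (real n)) \<longlonglongrightarrow> 0" by real_asymp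
        from tendsto_add[OF tendsto_const[of z0] tendsto_mult[OF tendsto_const[of a] tendsto_of_real[OF this]]]
        show "(\<lambda>n. z0 + a * 1 / of_real (sqrt (real n))) \<longlonglongrightarrow> z0" by simp
      qed
      show "exp (cnj a * a) = of_real (exp ((cmod a)\<^sup>2) * 1)" for a
        using complex_norm_square[of a] by (simp add: exp_of_real[symmetric] mult.commute del: of_real_power)
    qed auto
    then show "(\<lambda>n. cmod (1 / of_nat n * K n (z0 + a / of_real (sqrt (real n))) (z0 + b / of_real (sqrt (real n)))))
      \<longlonglongrightarrow> 1 / pi * exp (- (cmod (a - b))\<^sup>2 / 2)"
      using gaussian_modulus[of a b] by (simp add: mult.assoc)
  next
    fix z0 \<phi> assume z0: "z0 \<in> ellipse t" and \<phi>: "\<phi> \<in> {-pi<..pi}"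
      and z0_eq: "z0 = of_real (semiaxis_a t * cos \<phi>) + \<i> * of_real (semiaxis_b t * sin \<phi>)"
    define \<omega> where "\<omega> = exp (\<i> * of_real (normal_angle t \<phi>))"
    have \<omega>: "cmod \<omega> = 1" by (simp add: \<omega>_def)
    obtain L where L: "L > 0" "of_real L * \<omega> = Complex (semiaxis_b t * cos \<phi>) (semiaxis_a t * sin \<phi>)"
      using normal_angle_direction[OF t, of \<phi>] \<phi> unfolding \<omega>_def by auto
    have on: "(1 - t\<^sup>2) * ((Re z0)\<^sup>2 / (1 + t)\<^sup>2 + (Im z0)\<^sup>2 / (1 - t)\<^sup>2) = 1"
      using z0 ellipse_form[OF t, of z0] by (simp add: ellipse_def)
    note dir = normal_direction[OF t \<omega> L z0_eq]
    have "(\<lambda>n. cmod (1 / of_nat n * K n (z0 + a * \<omega> / of_real (sqrt (real n))) (z0 + b * \<omega> / of_real (sqrt (real n)))))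
      \<longlonglongrightarrow> 1 / pi * exp (- ((cmod a)\<^sup>2 + (cmod b)\<^sup>2) / 2) *
        cmod (exp (cnj a * b) * (erfc ((cnj a + b) / of_real (sqrt 2)) / 2))"
      unfolding K_def
    \<comment> \<open>The normal distribution function at - 2 Re a equals erfc (sqrt 2 * Re a) / 2,
      and sqrt 2 * Re a = (cnj a + a) / sqrt 2. Replacing \<open>cnj a\<close> by u and a by v gives
      H.\<close>
    proof (rule kernel_limit[OF orth \<omega>, where F = "\<lambda>a. cdf std_normal_distribution (- (2 * Re a))"
          and H = "\<lambda>u v. exp (u * v) * (erfc ((u + v) / of_real (sqrt 2)) / 2)"])
      show "(\<lambda>x. exp ((\<alpha> * x + \<beta>) * (\<gamma> * x + \<delta>)) * (erfc (((\<alpha> * x + \<beta>) + (\<gamma> * x + \<delta>)) / of_real (sqrt 2)) / 2)) holomorphic_on UNIV" for \<alpha> \<beta> \<gamma> \<delta>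
        by (intro holomorphic_intros holomorphic_on_erfc) auto
      show "(\<lambda>n. \<Sum>k<n. index_density t n (p n) (z0 + a * \<omega> / of_real (sqrt (real n))) k)
          \<longlonglongrightarrow> cdf std_normal_distribution (- (2 * Re a))" for a
        by (rule tendsto_edge[OF t orth on dir(1) L(1) dir(2)])
      show "exp (cnj a * a) * (erfc ((cnj a + a) / of_real (sqrt 2)) / 2) =
         of_real (exp ((cmod a)\<^sup>2) * cdf std_normal_distribution (- (2 * Re a)))" for a
      proof -
        have "exp (cnj a * a) = of_real (exp ((cmod a)\<^sup>2))"
          using complex_norm_square[of a] by (simp add: exp_of_real[symmetric] mult.commute del: of_real_power)
        moreover have "(cnj a + a) / of_real (sqrt 2) = of_real (2 * Re a / sqrt 2)"
          using complex_add_cnj[of a] by (simp add: add.commute)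
        moreover have "sqrt 2 * (2 * Re a / sqrt 2) = 2 * Re a" by simp
        ultimately show ?thesis by (simp only: erfc_of_real) simp
      qed
    qed
    also have "1 / pi * exp (- ((cmod a)\<^sup>2 + (cmod b)\<^sup>2) / 2) * cmod (exp (cnj a * b) * (erfc ((cnj a + b) / of_real (sqrt 2)) / 2)) =
       1 / (2 * pi) * exp (- (cmod (a - b))\<^sup>2 / 2) * cmod (erfc ((cnj a + b) / of_real (sqrt 2)))"
      unfolding gaussian_modulus[symmetric] by (simp add: norm_mult norm_divide)
    finally show "(\<lambda>n. cmod (1 / of_nat n *
                  K n (z0 + a * exp (\<i> * of_real (normal_angle t \<phi>)) / of_real (sqrt (real n)))
                      (z0 + b * exp (\<i> * of_real (normal_angle t \<phi>)) / of_real (sqrt (real n)))))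
           \<longlonglongrightarrow> 1 / (2 * pi) * exp (- (cmod (a - b))\<^sup>2 / 2)
                 * cmod (erfc ((cnj a + b) / of_real (sqrt 2)))"
      unfolding \<omega>_def .
  }
qed

end
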